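(* Let $\mathbf{K}_X=\mathbf{U}\,\mathrm{diag}(\bm\lambda)\,\mathbf{U}^\top$ and $\mathbf{K}_Y=\mathbf{V}\,\mathrm{diag}(\bm\mu)\,\mathbf{V}^\top$ be two nonzero standard kernels of size $n\times n$ with the same weight vector $\mathbf{f}$, let $\mathbf{T}$ be a Haar-distributed random element of $\mathbb{O}_{n-1}$, and let $$\mathtt{RV}=\mathtt{RV}(\mathbf{T})=\frac{\mathtt{CV}(\mathbf{T})}{\sqrt{\mathrm{Tr}(\mathbf{K}_X^2)\,\mathrm{Tr}(\mathbf{K}_Y^2)}},\qquad \mathtt{CV}(\mathbf{T})=\mathrm{Tr}\bigl(\mathbf{U}\mathbf{T}\,\mathrm{diag}(\bm\lambda)\,\mathbf{T}^\top\mathbf{U}^\top\,\mathbf{V}\,\mathrm{diag}(\bm\mu)\,\mathbf{V}^\top\bigr).$$ Put $\mathtt{RV}_c=\mathtt{RV}-\mathbb{E}(\mathtt{RV})$. Then: (i) for $n\ge 2$, $$\mathbb{E}(\mathtt{RV})=\frac1{n-1}\,\frac{\mathrm{Tr}(\mathbf{K}_X)\,\mathrm{Tr}(\mathbf{K}_Y)}{\sqrt{\mathrm{Tr}(\mathbf{K}_X^2)\,\mathrm{Tr}(\mathbf{K}_Y^2)}}=\frac{\overline{\bm\lambda}\;\overline{\bm\mu}}{\sqrt{\overline{\bm\lambda^2}\;\overline{\bm\mu^2}}}=\frac{\sqrt{\nu(\bm\lambda)\,\nu(\bm\mu)}}{n-1};$$ (ii) for $n\ge 3$, $$\mathrm{Var}(\mathtt{RV})=\mathbb{E}(\mathtt{RV}_c^2)=\frac{2\,(n-1-\nu(\bm\lambda))\,(n-1-\nu(\bm\mu))}{(n-2)(n-1)^2(n+1)};$$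 (iii) for $n\ge 4$, if $\overline{\bm\lambda_c^2}>0$ and $\overline{\bm\mu_c^2}>0$, the skewness is $$\frac{\mathbb{E}(\mathtt{RV}_c^3)}{\mathbb{E}(\mathtt{RV}_c^2)^{3/2}}=\frac{\sqrt{8(n-2)(n+1)}}{(n-3)(n+3)}\;a(\bm\lambda)\,a(\bm\mu);$$ (iv) for $n\ge 5$, if $\overline{\bm\lambda_c^2}>0$ and $\overline{\bm\mu_c^2}>0$, the excess kurtosis is $$\frac{\mathbb{E}(\mathtt{RV}_c^4)}{\mathbb{E}(\mathtt{RV}_c^2)^2}-3=\frac{m_4}{m_2^2}-3,$$ where $$m_2=\frac{2(n-1)^2}{(n-2)(n+1)}\;\overline{\bm\lambda_c^2}\;\overline{\bm\mu_c^2},$$ $$m_4=\frac{12\,(n-1)^3}{(n-4)(n-3)(n-2)\,n\,(n+1)(n+3)(n+5)}\Bigl\{4(n^2-n+2)\,\overline{\bm\lambda_c^4}\;\overline{\bm\mu_c^4}+(n^4+n^3-15n^2-13n+98)\,\bigl(\overline{\bm\lambda_c^2}\bigr)^2\bigl(\overline{\bm\mu_c^2}\bigr)^2-4(2n^2-n-7)\Bigl(\overline{\bm\lambda_c^4}\,\bigl(\overline{\bm\mu_c^2}\bigr)^2+\bigl(\overline{\bm\lambda_c^2}\bigr)^2\,\overline{\bm\mu_c^4}\Bigr)\Bigr\}$$ are the second and fourth centered moments of $\mathtt{CV}(\mathbf{T})$.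
   Context: Let $\mathbf{f}=(f_1,\dots,f_n)$ with $f_i>0$ and $\sum_i f_i=1$, and let $\sqrt{\mathbf{f}}=(\sqrt{f_1},\dots,\sqrt{f_n})^\top$. A standard kernel (with weights $\mathbf{f}$) is a real symmetric positive semi-definite $n\times n$ matrix $\mathbf{K}$ with $\mathbf{K}\sqrt{\mathbf{f}}=\mathbf{0}$. Discarding the trivial eigenvector $\sqrt{\mathbf{f}}$ (eigenvalue $0$), one writes $\mathbf{K}_X=\mathbf{U}\,\mathrm{diag}(\bm\lambda)\,\mathbf{U}^\top$, where $\mathbf{U}\in\mathbb{R}^{n\times(n-1)}$ satisfies $\mathbf{U}^\top\mathbf{U}=\mathbf{I}_{n-1}$, $\mathbf{U}\mathbf{U}^\top=\mathbf{I}_n-\sqrt{\mathbf{f}}\sqrt{\mathbf{f}}^\top$, $\mathbf{U}^\top\sqrt{\mathbf{f}}=\mathbf{0}$, and $\bm\lambda=(\lambda_1,\dots,\lambda_{n-1})$ are the remaining eigenvalues $\lambda_1\ge\dots\ge\lambda_{n-1}\ge 0$. Similarly $\mathbf{K}_Y=\mathbf{V}\,\mathrm{diag}(\bm\mu)\,\mathbf{V}^\top$ with the same properties for $\mathbf{V}$ and $\bm\mu=(\mu_1,\dots,\mu_{n-1})$. Spectral moments and centered spectral moments: $\overline{\bm\lambda^q}=\frac1{n-1}\sum_{\alpha=1}^{n-1}\lambda_\alpha^q$, $\overline{\bm\lambda}=\overline{\bm\lambda^1}$, $\overline{\bm\lambda_c^q}=\frac1{n-1}\sum_{\alpha=1}^{n-1}(\lambda_\alpha-\overline{\bm\lambda})^q$,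 and similarly for $\bm\mu$. Effective dimensionality: $\nu(\bm\lambda)=\dfrac{(\sum_\alpha\lambda_\alpha)^2}{\sum_\alpha\lambda_\alpha^2}=\dfrac{\mathrm{Tr}(\mathbf{K}_X)^2}{\mathrm{Tr}(\mathbf{K}_X^2)}$, and similarly $\nu(\bm\mu)$. Spectral skewness: $a(\bm\lambda)=\overline{\bm\lambda_c^3}/(\overline{\bm\lambda_c^2})^{3/2}$, and similarly $a(\bm\mu)$. Expectations $\mathbb{E}$ are with respect to the normalized invariant Haar (probability) measure on $\mathbb{O}_{n-1}$, the group of real orthogonal $(n-1)\times(n-1)$ matrices. *)

theory Defs
  imports "HOL-Probability.Probability"
begin

(* The n objects are indexed by a finite type 'n and the n - 1 nontrivial dimensions by a
   finite type 'm with CARD('n) = CARD('m) + 1.  A matrix with n rows and n - 1 columns is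
   then of type real^'m^'n. *)

definition weights :: "real^'n \<Rightarrow> bool" where
  "weights f \<longleftrightarrow> (\<forall>i. 0 < f $ i) \<and> (\<Sum>i\<in>UNIV. f $ i) = 1"

definition sqrt_vec :: "real^'n \<Rightarrow> real^'n" where
  "sqrt_vec f = (\<chi> i. sqrt (f $ i))"

definition standard_kernel :: "real^'n \<Rightarrow> real^'n^'n \<Rightarrow> bool" where
  "standard_kernel f K \<longleftrightarrow>
     transpose K = K \<and> (\<forall>x. 0 \<le> x \<bullet> (K *v x)) \<and> K *v sqrt_vec f = 0"

definition diag_mat :: "real^'m \<Rightarrow> real^'m^'m" where
  "diag_mat v = (\<chi> i j. if i = j then v $ i else 0)"

(* The linear order on 'm only serves to list the eigenvalues decreasingly. *)

definition spectral_decomposition ::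
  "real^'n \<Rightarrow> real^'n^'n \<Rightarrow> real^('m::{finite,linorder})^'n \<Rightarrow> real^('m::{finite,linorder}) \<Rightarrow> bool" where
  "spectral_decomposition f K U lam \<longleftrightarrow>
     K = U ** diag_mat lam ** transpose U \<and>
     transpose U ** U = mat 1 \<and>
     U ** transpose U = mat 1 - (\<chi> i j. sqrt_vec f $ i * sqrt_vec f $ j) \<and>
     transpose U *v sqrt_vec f = 0 \<and>
     (\<forall>\<alpha> \<beta>. \<alpha> \<le> \<beta> \<longrightarrow> lam $ \<beta> \<le> lam $ \<alpha>) \<and>
     (\<forall>\<alpha>. 0 \<le> lam $ \<alpha>)"

definition spec_moment :: "nat \<Rightarrow> real^'m \<Rightarrow> real" where
  "spec_moment q lam = (\<Sum>\<alpha>\<in>UNIV. lam $ \<alpha> ^ q) / real CARD('m)"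

definition spec_cmoment :: "nat \<Rightarrow> real^'m \<Rightarrow> real" where
  "spec_cmoment q lam = (\<Sum>\<alpha>\<in>UNIV. (lam $ \<alpha> - spec_moment 1 lam) ^ q) / real CARD('m)"

definition eff_dim :: "real^'m \<Rightarrow> real" where
  "eff_dim lam = (\<Sum>\<alpha>\<in>UNIV. lam $ \<alpha>)\<^sup>2 / (\<Sum>\<alpha>\<in>UNIV. (lam $ \<alpha>)\<^sup>2)"

definition spec_skewness :: "real^'m \<Rightarrow> real" where
  "spec_skewness lam = spec_cmoment 3 lam / spec_cmoment 2 lam powr (3/2)"

(* Left-invariance suffices: on a compact group the left-invariant probability measure is
   unique and also right-invariant. *)

definition haar_orthogonal :: "(real^'m^'m) measure \<Rightarrow> bool" where
  "haar_orthogonal H \<longleftrightarrow>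
     prob_space H \<and>
     sets H = sets (restrict_space borel {Q. orthogonal_matrix Q}) \<and>
     (\<forall>Q. orthogonal_matrix Q \<longrightarrow> distr H H (\<lambda>A. Q ** A) = H)"

definition CV ::
  "real^'m^'n \<Rightarrow> real^'m \<Rightarrow> real^'m^'n \<Rightarrow> real^'m \<Rightarrow> real^'m^'m \<Rightarrow> real" where
  "CV U lam V mu T =
     trace (U ** T ** diag_mat lam ** transpose T ** transpose U **
            V ** diag_mat mu ** transpose V)"

definition RV ::
  "real^'n^'n \<Rightarrow> real^'m^'n \<Rightarrow> real^'m \<Rightarrow> real^'n^'n \<Rightarrow> real^'m^'n \<Rightarrow> real^'m \<Rightarrow> real^'m^'m \<Rightarrow> real"
  where
  "RV KX U lam KY V mu T = CV U lam V mu T / sqrt (trace (KX ** KX) * trace (KY ** KY))"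

definition central_moment :: "'w measure \<Rightarrow> nat \<Rightarrow> ('w \<Rightarrow> real) \<Rightarrow> real" where
  "central_moment M k X = (\<integral>\<omega>. (X \<omega> - (\<integral>\<omega>'. X \<omega>' \<partial>M)) ^ k \<partial>M)"

end

theory Submission
  imports Defs
begin

text \<open>
  Since \<open>V\<^sup>T U\<close> is orthogonal, left invariance reduces \<open>CV\<close> to the statistic
  \<open>\<Sum>i. \<mu> i * X i i\<close> of the random symmetric matrix \<open>X = T diag(\<lambda>) T\<^sup>T\<close>, and one may centre
  \<open>\<lambda>\<close> and \<open>\<mu>\<close>, which makes \<open>tr X = 0\<close>.  The traces of the powers of \<open>X\<close> are deterministic.
  Differentiating the invariance of the expectation under rotations of two rows of \<open>T\<close> gives linear
  recurrences between the moments of the entries of \<open>X\<close> and of its powers.  Together with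
  \<open>tr X = 0\<close> and exchangeability of the rows they determine every moment of the diagonal of \<open>X\<close> up
  to degree four, which is all that is needed.
\<close>

subsection \<open>Orthogonal matrices and plane rotations\<close>

text \<open>Write \<open>d\<close> for \<open>CARD('m)\<close>, so that \<open>n = d + 1\<close>. A
  moment of diagonal entries in which some index occurs exactly once reduces, through tr X = 0, to
  moments with fewer distinct indices. These reductions divide by \<open>d - 1\<close>,
  \<open>d - 2\<close>, \<open>d - 3\<close>, which explains the thresholds 3, 4, 5 for
  \<open>n\<close>. Moments of a single entry come from a recurrence whose coefficients
  \<open>d + 2 * \<alpha>\<close> give the factors \<open>d + 2\<close>, \<open>d + 4\<close>,
  \<open>d + 6\<close>. The obstacle is the moment of
  \<open>X\<^sub>a\<^sup>2 X\<^sub>b\<^sup>2\<close>: no index occurs once, and its recurrence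
  involves the off-diagonal entry of X at \<open>(a, b)\<close>. Two rotation identities for the
  pair \<open>a\<close>, \<open>b\<close>, used without summation, eliminate the off-diagonal
  moments and leave a division by \<open>d + 1\<close>.\<close>

lemma orthogonal_matrix_rows:
  fixes T :: "real^'m^'m"
  assumes "orthogonal_matrix T"
  shows "(\<Sum>c\<in>UNIV. T $ a $ c * T $ b $ c) = (if a = b then 1 else 0)"
proof -
  have "T ** transpose T = mat 1"
    using assms by (simp add: orthogonal_matrix_def)
  then have "(T ** transpose T) $ a $ b = (mat 1 :: real^'m^'m) $ a $ b"
    by simp
  then show ?thesis
    by (simp add: matrix_matrix_mult_def transpose_def mat_def)
qed

lemma orthogonal_matrix_columns:
  fixes T :: "real^'m^'m"
  assumes "orthogonal_matrix T"
  shows "(\<Sum>a\<in>UNIV. T $ a $ c * T $ a $ e) = (if c = e then 1 else 0)"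
  using orthogonal_matrix_rows[of "transpose T" c e, unfolded orthogonal_matrix_transpose, OF assms]
  by (simp add: transpose_def)

lemma orthogonal_matrix_iff_rows:
  fixes T :: "real^'m^'m"
  shows "orthogonal_matrix T \<longleftrightarrow>
    (\<forall>a b. (\<Sum>c\<in>UNIV. T $ a $ c * T $ b $ c) = (if a = b then 1 else 0))"
proof
  assume "\<forall>a b. (\<Sum>c\<in>UNIV. T $ a $ c * T $ b $ c) = (if a = b then 1 else 0)"
  then have "T ** transpose T = mat 1"
    by (simp add: vec_eq_iff matrix_matrix_mult_def transpose_def mat_def)
  then have "orthogonal_matrix (transpose T)"
    by (simp add: orthogonal_matrix)
  then show "orthogonal_matrix T"
    by (simp add: orthogonal_matrix_transpose)
qed (simp add: orthogonal_matrix_rows)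

lemma compact_orthogonal_matrices:
  "compact {T :: real^'m^'m. orthogonal_matrix T}"
proof -
  have "closed {T :: real^'m^'m. orthogonal_matrix T}"
    unfolding orthogonal_matrix_iff_rows
    by (intro closed_Collect_all closed_Collect_eq continuous_intros)
  moreover have "bounded {T :: real^'m^'m. orthogonal_matrix T}"
  proof -
    have "norm T \<le> real CARD('m)" if "orthogonal_matrix T" for T :: "real^'m^'m"
    proof -
      have "norm (T $ a) = 1" for a
        using orthogonal_matrix_rows[OF that, of a a]
        by (simp add: norm_eq_sqrt_inner inner_vec_def)
      then show ?thesis
        using norm_le_componentwise_cart[of T] L2_set_le_sum[of UNIV "\<lambda>i. norm (T $ i)"]
        by (simp add: norm_vec_def)
    qed
    then show ?thesis
      by (auto simp: bounded_iff)
  qed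
  ultimately show ?thesis
    by (simp add: compact_eq_bounded_closed)
qed

text \<open>For orthogonal \<open>T\<close>, the entry \<open>(a, b)\<close> of \<open>X\<^sup>k\<close>, where \<open>X = T diag(lam) T\<^sup>T\<close>.\<close>

definition pow_entry :: "real^'m \<Rightarrow> nat \<Rightarrow> 'm \<Rightarrow> 'm \<Rightarrow> real^'m^'m \<Rightarrow> real" where
  "pow_entry lam k a b T = (\<Sum>c\<in>UNIV. lam $ c ^ k * T $ a $ c * T $ b $ c)"

definition rotate_rows :: "'m \<Rightarrow> 'm \<Rightarrow> real \<Rightarrow> real^'m^'m \<Rightarrow> real^'m^'m" where
  "rotate_rows a b t T = (\<chi> x. if x = a then cos t *\<^sub>R T $ a + sin t *\<^sub>R T $ b
     else if x = b then cos t *\<^sub>R T $ b - sin t *\<^sub>R T $ a else T $ x)"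

lemma continuous_on_pow_entry [continuous_intros]:
  "continuous_on S (pow_entry lam k a b)"
  unfolding pow_entry_def by (intro continuous_intros)

lemma pow_entry_commute: "pow_entry lam k a b T = pow_entry lam k b a T"
  by (simp add: pow_entry_def mult_ac)

lemma pow_entry_rotate_rows:
  fixes T :: "real^'m^'m"
  assumes "a \<noteq> b"
  shows "pow_entry lam k a a (rotate_rows a b t T) = (cos t)\<^sup>2 * pow_entry lam k a a T
           + 2 * cos t * sin t * pow_entry lam k a b T + (sin t)\<^sup>2 * pow_entry lam k b b T"
    and "pow_entry lam k b b (rotate_rows a b t T) = (cos t)\<^sup>2 * pow_entry lam k b b T
           - 2 * cos t * sin t * pow_entry lam k a b T + (sin t)\<^sup>2 * pow_entry lam k a a T"
    and "pow_entry lam k a b (rotate_rows a b t T) = ((cos t)\<^sup>2 - (sin t)\<^sup>2) * pow_entry lam k a b T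
           + cos t * sin t * (pow_entry lam k b b T - pow_entry lam k a a T)"
    and "c \<noteq> a \<Longrightarrow> c \<noteq> b \<Longrightarrow> pow_entry lam k c c (rotate_rows a b t T) = pow_entry lam k c c T"
  using assms
  by (auto simp: pow_entry_def rotate_rows_def sum_distrib_left power2_eq_square
      simp flip: sum.distrib sum_subtractf intro!: sum.cong)
     (simp_all add: algebra_simps)

text \<open>Rotations of one plane form a one-parameter group, so the derivative at every
  \<open>t\<close> is the same expression in the entries of the rotated matrix. This shape is what
  \<open>integral_rotation_derivative\<close> asks for.\<close>

lemma has_real_derivative_pow_entry_rotate_rows:
  fixes T :: "real^'m^'m"
  assumes "a \<noteq> b"
  shows "((\<lambda>t. pow_entry lam k a a (rotate_rows a b t T)) has_real_derivative
            2 * pow_entry lam k a b (rotate_rows a b t T)) (at t)"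
    and "((\<lambda>t. pow_entry lam k b b (rotate_rows a b t T)) has_real_derivative
            - 2 * pow_entry lam k a b (rotate_rows a b t T)) (at t)"
    and "((\<lambda>t. pow_entry lam k a b (rotate_rows a b t T)) has_real_derivative
            pow_entry lam k b b (rotate_rows a b t T) - pow_entry lam k a a (rotate_rows a b t T)) (at t)"
    and "c \<noteq> a \<Longrightarrow> c \<noteq> b \<Longrightarrow>
           ((\<lambda>t. pow_entry lam k c c (rotate_rows a b t T)) has_real_derivative 0) (at t)"
  unfolding pow_entry_rotate_rows[OF assms]
  by (auto simp: pow_entry_rotate_rows[OF assms] intro!: derivative_eq_intros)
     (simp_all add: algebra_simps power2_eq_square)

text \<open>Left invariance applies to rotations of rows through this form.\<close>

lemma rotate_rows_eq_mult: "rotate_rows a b t T = rotate_rows a b t (mat 1) ** T"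
  by (auto simp: vec_eq_iff rotate_rows_def matrix_matrix_mult_def mat_def algebra_simps
      if_distrib[of "\<lambda>x. x * _"] if_distrib[of "\<lambda>x. _ * x"] sum.distrib sum_subtractf cong: if_cong)

lemma rotate_rows_0 [simp]: "rotate_rows a b 0 T = T"
  by (simp add: rotate_rows_def vec_eq_iff)

lemma pow_entry_0: "orthogonal_matrix T \<Longrightarrow> pow_entry lam 0 a b T = (if a = b then 1 else 0)"
  by (simp add: pow_entry_def orthogonal_matrix_rows)

lemma pow_entry_rotate_rows_off:
  assumes "a \<noteq> b" "x \<noteq> a" "x \<noteq> b"
  shows "pow_entry lam k a x (rotate_rows a b t T) = cos t * pow_entry lam k a x T + sin t * pow_entry lam k b x T"
    and "pow_entry lam k b x (rotate_rows a b t T) = cos t * pow_entry lam k b x T - sin t * pow_entry lam k a x T"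
    and "y \<noteq> a \<Longrightarrow> y \<noteq> b \<Longrightarrow> pow_entry lam k x y (rotate_rows a b t T) = pow_entry lam k x y T"
  using assms
  by (auto simp: pow_entry_def rotate_rows_def sum_distrib_left
      simp flip: sum.distrib sum_subtractf intro!: sum.cong)
     (simp_all add: algebra_simps)

lemma orthogonal_matrix_rotate_rows:
  assumes "a \<noteq> b" "orthogonal_matrix T"
  shows "orthogonal_matrix (rotate_rows a b t T)"
proof -
  \<comment> \<open>With exponent 0 all weights are 1, so \<open>pow_entry 0 0 x y\<close> is the
    inner product of the rows \<open>x\<close> and \<open>y\<close>, and the rotation formulas yield
    orthonormality.\<close>
  have "pow_entry 0 0 x y (rotate_rows a b t T) = (if x = y then 1 else 0)" for x y
  proof -
    consider "x = a" "y = a" | "x = a" "y = b" | "x = b" "y = a" | "x = b" "y = b"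
      | "x = a" "y \<notin> {a, b}" | "x = b" "y \<notin> {a, b}" | "y = a" "x \<notin> {a, b}" | "y = b" "x \<notin> {a, b}"
      | "x \<notin> {a, b}" "y \<notin> {a, b}"
      by blast
    then show ?thesis
      using assms
      by cases (auto simp: pow_entry_rotate_rows pow_entry_rotate_rows_off pow_entry_0
          pow_entry_commute[of _ _ b a] pow_entry_commute[of _ _ x a] pow_entry_commute[of _ _ x b])
  qed
  then show ?thesis
    by (simp add: orthogonal_matrix_iff_rows pow_entry_def)
qed

subsection \<open>Consequences of left invariance\<close>

definition swap_rows :: "'m \<Rightarrow> 'm \<Rightarrow> real^'m^'m \<Rightarrow> real^'m^'m" where
  "swap_rows a b T = (\<chi> x. T $ Transposition.transpose a b x)"

lemma pow_entry_swap_rows: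
  "pow_entry lam k x y (swap_rows a b T)
     = pow_entry lam k (Transposition.transpose a b x) (Transposition.transpose a b y) T"
  by (simp add: pow_entry_def swap_rows_def)

locale haar_spectrum =
  fixes H :: "(real^'m^'m) measure" and lam :: "real^'m"
  assumes haar: "haar_orthogonal H"
begin

sublocale prob_space H
  using haar by (simp add: haar_orthogonal_def)

lemma sets_H: "sets H = sets (restrict_space borel {Q. orthogonal_matrix Q})"
  using haar by (simp add: haar_orthogonal_def)

lemma space_H: "space H = {Q. orthogonal_matrix Q}"
  using sets_eq_imp_space_eq[OF sets_H] by (simp add: space_restrict_space)

lemma integral_cong_orthogonal:
  "(\<And>T. orthogonal_matrix T \<Longrightarrow> f T = g T) \<Longrightarrow> integral\<^sup>L H f = integral\<^sup>L H g"
  by (rule Bochner_Integration.integral_cong) (auto simp: space_H)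

lemma borel_measurable_continuous:
  fixes g :: "real^'m^'m \<Rightarrow> 'b::topological_space"
  assumes "continuous_on UNIV g"
  shows "g \<in> borel_measurable H"
  using borel_measurable_continuous_onI[OF assms]
  by (simp add: measurable_cong_sets[OF sets_H refl] measurable_restrict_space1)

lemma bounded_continuous:
  fixes g :: "real^'m^'m \<Rightarrow> real"
  assumes "continuous_on UNIV g"
  obtains K where "0 \<le> K" "\<And>T. orthogonal_matrix T \<Longrightarrow> \<bar>g T\<bar> \<le> K"
proof -
  have "bounded (g ` {T. orthogonal_matrix T})"
    by (intro compact_imp_bounded compact_continuous_image compact_orthogonal_matrices
        continuous_on_subset[OF assms]) auto
  then obtain K where K: "\<forall>T. orthogonal_matrix T \<longrightarrow> \<bar>g T\<bar> \<le> K"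
    by (auto simp: bounded_iff)
  moreover have "0 \<le> K"
    using K[rule_format, of "mat 1"] by (simp add: orthogonal_matrix_id)
  ultimately show ?thesis
    using that by blast
qed

lemma integrable_continuous:
  fixes g :: "real^'m^'m \<Rightarrow> real"
  assumes "continuous_on UNIV g"
  shows "integrable H g"
proof -
  obtain K where "\<And>T. orthogonal_matrix T \<Longrightarrow> \<bar>g T\<bar> \<le> K"
    using bounded_continuous[OF assms] by blast
  then show ?thesis
    by (intro integrable_const_bound[where B = K] AE_I2 borel_measurable_continuous assms)
       (auto simp: space_H)
qed

lemma integral_left_mult:
  fixes g :: "real^'m^'m \<Rightarrow> real"
  assumes "orthogonal_matrix Q" "continuous_on UNIV g"
  shows "(\<integral>T. g (Q ** T) \<partial>H) = (\<integral>T. g T \<partial>H)"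
proof -
  have "(\<lambda>T. Q ** T) \<in> borel \<rightarrow>\<^sub>M borel"
    by (intro borel_measurable_continuous_onI)
       (auto simp: matrix_matrix_mult_def intro!: continuous_intros)
  then have "(\<lambda>T. Q ** T) \<in> H \<rightarrow>\<^sub>M H"
    unfolding measurable_cong_sets[OF sets_H sets_H]
    by (intro measurable_restrict_space2 measurable_restrict_space1)
       (simp_all add: space_restrict_space orthogonal_matrix_mul assms(1))
  then have "(\<integral>T. g (Q ** T) \<partial>H) = (\<integral>T. g T \<partial>distr H H (\<lambda>T. Q ** T))"
    by (intro integral_distr[symmetric] borel_measurable_continuous assms)
  then show ?thesis
    using haar assms(1) by (simp add: haar_orthogonal_def)
qed

lemma integral_rotate_rows:
  fixes g :: "real^'m^'m \<Rightarrow> real"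
  assumes "a \<noteq> b" "continuous_on UNIV g"
  shows "(\<integral>T. g (rotate_rows a b t T) \<partial>H) = (\<integral>T. g T \<partial>H)"
  using integral_left_mult[OF orthogonal_matrix_rotate_rows[OF assms(1) orthogonal_matrix_id] assms(2)]
  by (simp flip: rotate_rows_eq_mult)

text \<open>By invariance the integral of \<open>g\<close> after a rotation does not depend on the
  angle. Differentiation under the integral is justified by compactness: \<open>g'\<close> is
  bounded on the orthogonal matrices, and by the mean value theorem the same bound dominates the
  difference quotients.\<close>

lemma integral_rotation_derivative:
  fixes g g' :: "real^'m^'m \<Rightarrow> real"
  assumes ab: "a \<noteq> b" and g: "continuous_on UNIV g" and g': "continuous_on UNIV g'"
    and deriv: "\<And>T t. ((\<lambda>t. g (rotate_rows a b t T)) has_real_derivative g' (rotate_rows a b t T)) (at t)"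
  shows "(\<integral>T. g' T \<partial>H) = 0"
proof -
  obtain K where K: "\<And>T. orthogonal_matrix T \<Longrightarrow> \<bar>g' T\<bar> \<le> K"
    using bounded_continuous[OF g'] by blast
  define h where "h n = inverse (real (Suc n))" for n
  have h: "h n > 0" "h \<longlonglongrightarrow> 0" for n
    using LIMSEQ_inverse_real_of_nat by (simp_all add: h_def[abs_def])
  define s where "s n T = (g (rotate_rows a b (h n) T) - g T) / h n" for n T
  have cont: "continuous_on UNIV (\<lambda>T. g (rotate_rows a b t T))" for t
  proof -
    have "continuous_on UNIV (\<lambda>T. g (rotate_rows a b t (mat 1) ** T))"
      by (rule continuous_on_compose2[OF g])
         (auto simp: matrix_matrix_mult_def intro!: continuous_intros)
    then show ?thesis
      by (simp flip: rotate_rows_eq_mult)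
  qed
  have zero: "(\<integral>T. s n T \<partial>H) = 0" for n
    by (simp add: s_def Bochner_Integration.integral_diff integrable_continuous g cont
        integral_rotate_rows[OF ab g])
  have lim: "(\<lambda>n. s n T) \<longlonglongrightarrow> g' T" for T
  proof -
    have "((\<lambda>t. (g (rotate_rows a b t T) - g T) / t) \<longlongrightarrow> g' T) (at 0)"
      using deriv[of T 0] by (simp add: DERIV_def)
    moreover have "filterlim h (at 0) sequentially"
      using h by (auto simp: filterlim_at less_imp_neq[symmetric])
    ultimately show ?thesis
      unfolding s_def by (rule filterlim_compose)
  qed
  have bound: "\<bar>s n T\<bar> \<le> K" if "orthogonal_matrix T" for n T
  proof -
    obtain z where "g (rotate_rows a b (h n) T) - g (rotate_rows a b 0 T)
        = (h n - 0) * g' (rotate_rows a b z T)"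
      using MVT2[of 0 "h n" "\<lambda>t. g (rotate_rows a b t T)" "\<lambda>t. g' (rotate_rows a b t T)"] h deriv
      by blast
    then show ?thesis
      using K[OF orthogonal_matrix_rotate_rows[OF ab that]] h(1)[of n] by (simp add: s_def)
  qed
  have "(\<lambda>n. \<integral>T. s n T \<partial>H) \<longlonglongrightarrow> (\<integral>T. g' T \<partial>H)"
    using bound lim g' less_imp_neq[OF h(1), symmetric]
    by (intro integral_dominated_convergence[where w = "\<lambda>_. K"] AE_I2 borel_measurable_continuous)
       (auto simp: space_H s_def intro!: continuous_intros g cont borel_measurable_continuous)
  then show ?thesis
    by (simp add: zero LIMSEQ_const_iff)
qed

lemma integral_swap_rows:
  fixes g :: "real^'m^'m \<Rightarrow> real"
  assumes "continuous_on UNIV g"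
  shows "(\<integral>T. g (swap_rows a b T) \<partial>H) = (\<integral>T. g T \<partial>H)"
proof -
  have "orthogonal_matrix (swap_rows a b (mat 1))"
  proof -
    have "pow_entry 0 0 x y (swap_rows a b (mat 1)) = (if x = y then 1 else 0)" for x y
      by (auto simp: pow_entry_swap_rows pow_entry_0 orthogonal_matrix_id dest: transpose_eq_imp_eq)
    then show ?thesis
      by (simp add: orthogonal_matrix_iff_rows pow_entry_def)
  qed
  moreover have "swap_rows a b (mat 1) ** T = swap_rows a b T" for T
    by (simp add: vec_eq_iff swap_rows_def matrix_matrix_mult_def mat_def
        if_distrib[of "\<lambda>x. x * _"] cong: if_cong)
  ultimately show ?thesis
    using integral_left_mult[OF _ assms, of "swap_rows a b (mat 1)"] by simp
qed

section \<open>Moment recurrences from rotations and traces\<close>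

abbreviation "q \<equiv> pow_entry lam"

lemma sum_pow_entry_diag:
  "orthogonal_matrix T \<Longrightarrow> (\<Sum>b\<in>UNIV. q k b b T) = (\<Sum>c\<in>UNIV. lam $ c ^ k)"
  unfolding pow_entry_def
  by (subst sum.swap) (simp add: orthogonal_matrix_columns mult.assoc flip: sum_distrib_left)

text \<open>This is the product of the powers of X with exponents \<open>k\<close> and
  \<open>l\<close> at position \<open>(a, a)\<close>, the second factor being symmetric.\<close>

lemma sum_pow_entry_mult:
  assumes "orthogonal_matrix T"
  shows "(\<Sum>b\<in>UNIV. q k a b T * q l a b T) = q (k + l) a a T"
proof -
  have "(\<Sum>b\<in>UNIV. q k a b T * q l a b T)
      = (\<Sum>b\<in>UNIV. \<Sum>c\<in>UNIV. \<Sum>e\<in>UNIV. lam $ c ^ k * T $ a $ c * lam $ e ^ l * T $ a $ e * (T $ b $ c * T $ b $ e))"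
    by (simp add: pow_entry_def sum_product mult_ac)
  also have "\<dots> = (\<Sum>c\<in>UNIV. \<Sum>e\<in>UNIV. \<Sum>b\<in>UNIV. lam $ c ^ k * T $ a $ c * lam $ e ^ l * T $ a $ e * (T $ b $ c * T $ b $ e))"
    by (subst sum.swap, rule sum.cong[OF refl], rule sum.swap)
  also have "\<dots> = q (k + l) a a T"
    by (simp add: orthogonal_matrix_columns[OF assms]
        if_distrib[of "\<lambda>x. _ * x"] cong: if_cong flip: sum_distrib_left)
       (simp add: pow_entry_def power_add mult_ac)
  finally show ?thesis .
qed

text \<open>The off-diagonal factor \<open>q k a b\<close> in the test function is chosen because
  its derivative is a difference of diagonal entries. The conditional separates
  \<open>c = b\<close>, where the rotation moves \<open>q 1 c c\<close>, from \<open>c\<close>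
  outside the plane. For \<open>\<alpha> = 0\<close> or \<open>\<gamma> = 0\<close> the truncated
  exponent stands behind a zero coefficient.\<close>

lemma integral_pair_identity:
  fixes \<alpha> \<gamma> :: nat
  assumes ab: "a \<noteq> b" and ac: "a \<noteq> c \<or> \<gamma> = 0"
  shows "(\<integral>T. (q k b b T - q k a a T) * (q 1 a a T ^ \<alpha> * q 1 c c T ^ \<gamma>)
     + 2 * \<alpha> * (q k a b T * q 1 a b T) * q 1 a a T ^ (\<alpha> - 1) * q 1 c c T ^ \<gamma>
     - 2 * \<gamma> * (if c = b then q k a b T * q 1 a b T else 0) * q 1 a a T ^ \<alpha> * q 1 c c T ^ (\<gamma> - 1) \<partial>H) = 0"
    (is "(\<integral>T. ?g' T \<partial>H) = 0")
proof (rule integral_rotation_derivative[OF ab, where g = "\<lambda>T. q k a b T * (q 1 a a T ^ \<alpha> * q 1 c c T ^ \<gamma>)"])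
  note D = has_real_derivative_pow_entry_rotate_rows[OF ab]
  show "((\<lambda>t. q k a b (rotate_rows a b t T) * (q 1 a a (rotate_rows a b t T) ^ \<alpha> * q 1 c c (rotate_rows a b t T) ^ \<gamma>))
      has_real_derivative ?g' (rotate_rows a b t T)) (at t)" for T t
  proof (cases "\<gamma> = 0")
    case True
    then show ?thesis
      by (auto intro!: derivative_eq_intros D simp: algebra_simps)
  next
    case False
    with ac have "a \<noteq> c" by simp
    show ?thesis
    proof (cases "c = b")
      case True
      then show ?thesis
        by (auto intro!: derivative_eq_intros D simp: algebra_simps)
    next
      case False
      then show ?thesis
        using \<open>a \<noteq> c\<close> D(4)[of c]
        by (auto intro!: derivative_eq_intros D simp: algebra_simps)
    qed
  qed
qed (cases "c = b"; simp; intro continuous_intros)+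

text \<open>
  Summation over \<open>b\<close> turns \<open>(X\<^sup>k)\<^bsub>bb\<^esub>\<close> into a deterministic trace and
  \<open>(X\<^sup>k)\<^bsub>ab\<^esub> X\<^bsub>ab\<^esub>\<close> into a diagonal entry of \<open>X\<^bsup>k+1\<^esup>\<close>, so that the result is a recurrence.
\<close>

lemma integral_row_identity:
  fixes \<alpha> \<gamma> :: nat
  assumes ac: "a \<noteq> c \<or> \<gamma> = 0"
  shows "(\<Sum>c\<in>UNIV. lam $ c ^ k) * (\<integral>T. q 1 a a T ^ \<alpha> * q 1 c c T ^ \<gamma> \<partial>H)
     - CARD('m) * (\<integral>T. q k a a T * q 1 a a T ^ \<alpha> * q 1 c c T ^ \<gamma> \<partial>H)
     + 2 * \<alpha> * ((\<integral>T. q (k + 1) a a T * q 1 a a T ^ (\<alpha> - 1) * q 1 c c T ^ \<gamma> \<partial>H)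
               - (\<integral>T. q k a a T * q 1 a a T * q 1 a a T ^ (\<alpha> - 1) * q 1 c c T ^ \<gamma> \<partial>H))
     - 2 * \<gamma> * (\<integral>T. q k a c T * q 1 a c T * q 1 a a T ^ \<alpha> * q 1 c c T ^ (\<gamma> - 1) \<partial>H) = 0"
proof -
  define I where "I b T = (q k b b T - q k a a T) * (q 1 a a T ^ \<alpha> * q 1 c c T ^ \<gamma>)
     + 2 * \<alpha> * (q k a b T * q 1 a b T) * q 1 a a T ^ (\<alpha> - 1) * q 1 c c T ^ \<gamma>
     - 2 * \<gamma> * (if c = b then q k a b T * q 1 a b T else 0) * q 1 a a T ^ \<alpha> * q 1 c c T ^ (\<gamma> - 1)" for b T
  have cont: "continuous_on UNIV (I b)" for b
    unfolding I_def by (cases "c = b"; simp; intro continuous_intros)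
  have "(\<integral>T. I b T \<partial>H) = 0" if "b \<noteq> a" for b
    using integral_pair_identity[of a b c \<gamma> k \<alpha>] that ac unfolding I_def by auto
  then have "(\<integral>T. I a T \<partial>H) = (\<Sum>b\<in>UNIV. \<integral>T. I b T \<partial>H)"
    by (subst sum.remove[of _ a]) auto
  also have "\<dots> = (\<integral>T. (\<Sum>b\<in>UNIV. I b T) \<partial>H)"
    by (simp add: Bochner_Integration.integral_sum integrable_continuous cont)
  also have "\<dots> = (\<integral>T. ((\<Sum>c\<in>UNIV. lam $ c ^ k) - CARD('m) * q k a a T) * (q 1 a a T ^ \<alpha> * q 1 c c T ^ \<gamma>)
     + 2 * \<alpha> * q (k + 1) a a T * q 1 a a T ^ (\<alpha> - 1) * q 1 c c T ^ \<gamma>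
     - 2 * \<gamma> * (q k a c T * q 1 a c T) * q 1 a a T ^ \<alpha> * q 1 c c T ^ (\<gamma> - 1) \<partial>H)"
    by (intro integral_cong_orthogonal)
       (simp add: I_def sum.distrib sum_subtractf sum_pow_entry_diag sum_pow_entry_mult
        flip: sum_distrib_left sum_distrib_right)
  also have "\<dots> = (\<Sum>c\<in>UNIV. lam $ c ^ k) * (\<integral>T. q 1 a a T ^ \<alpha> * q 1 c c T ^ \<gamma> \<partial>H)
     - CARD('m) * (\<integral>T. q k a a T * q 1 a a T ^ \<alpha> * q 1 c c T ^ \<gamma> \<partial>H)
     + 2 * \<alpha> * (\<integral>T. q (k + 1) a a T * q 1 a a T ^ (\<alpha> - 1) * q 1 c c T ^ \<gamma> \<partial>H)
     - 2 * \<gamma> * (\<integral>T. q k a c T * q 1 a c T * q 1 a a T ^ \<alpha> * q 1 c c T ^ (\<gamma> - 1) \<partial>H)"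
    by (simp add: integrable_continuous continuous_intros left_diff_distrib mult.assoc)
  finally have *: "(\<integral>T. I a T \<partial>H) = \<dots>" .
  \<comment> \<open>The rotation identities cover only \<open>b \<noteq> a\<close>, so the term
    \<open>b = a\<close> is computed directly: its difference of diagonal entries vanishes, and so
    does its last part, since \<open>c\<close> differs from \<open>a\<close> or
    \<open>\<gamma>\<close> is 0.\<close>
  have "(\<integral>T. I a T \<partial>H)
      = (\<integral>T. 2 * \<alpha> * (q k a a T * q 1 a a T * q 1 a a T ^ (\<alpha> - 1) * q 1 c c T ^ \<gamma>) \<partial>H)"
    using ac by (auto simp: I_def mult.assoc)
  with * show ?thesis
    by (simp add: right_diff_distrib)
qed

text \<open>Without summation over \<open>b\<close> the products
  \<open>q k a b T * q 1 a b T\<close> survive; these relations serve to eliminate them in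
  \<open>integral_X2X2\<close>.\<close>

lemma integral_pair_identity_split:
  fixes \<alpha> \<gamma> :: nat
  assumes ab: "a \<noteq> b"
  shows "(\<integral>T. q k b b T * q 1 a a T ^ \<alpha> * q 1 b b T ^ \<gamma> \<partial>H)
     - (\<integral>T. q k a a T * q 1 a a T ^ \<alpha> * q 1 b b T ^ \<gamma> \<partial>H)
     + 2 * \<alpha> * (\<integral>T. q k a b T * q 1 a b T * q 1 a a T ^ (\<alpha> - 1) * q 1 b b T ^ \<gamma> \<partial>H)
     - 2 * \<gamma> * (\<integral>T. q k a b T * q 1 a b T * q 1 a a T ^ \<alpha> * q 1 b b T ^ (\<gamma> - 1) \<partial>H) = 0"
  using integral_pair_identity[OF ab, of b \<gamma> k \<alpha>] ab
  by (simp add: integrable_continuous continuous_intros left_diff_distrib mult.assoc)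

text \<open>Since \<open>g\<close> does not distinguish \<open>c\<close> from the other rows outside
  \<open>S\<close>, every \<open>q k e e\<close> with \<open>e\<close> outside \<open>S\<close> has
  the same integral against \<open>g\<close>. All diagonal entries together add up to a
  deterministic trace.\<close>

lemma integral_trace_identity:
  assumes g: "continuous_on UNIV g" and c: "c \<notin> S"
    and swap: "\<And>e T. e \<notin> S \<Longrightarrow> g (swap_rows c e T) = g T"
  shows "(\<Sum>j\<in>S. \<integral>T. g T * q k j j T \<partial>H) + (real CARD('m) - card S) * (\<integral>T. g T * q k c c T \<partial>H)
    = (\<Sum>c\<in>UNIV. lam $ c ^ k) * (\<integral>T. g T \<partial>H)"
proof -
  have eq: "(\<integral>T. g T * q k e e T \<partial>H) = (\<integral>T. g T * q k c c T \<partial>H)" if "e \<notin> S" for e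
    using integral_swap_rows[of "\<lambda>T. g T * q k c c T" c e] that
    by (simp add: swap pow_entry_swap_rows continuous_intros g)
  have "(\<Sum>c\<in>UNIV. lam $ c ^ k) * (\<integral>T. g T \<partial>H) = (\<integral>T. g T * (\<Sum>j\<in>UNIV. q k j j T) \<partial>H)"
    by (subst mult.commute, subst integral_mult_left_zero[symmetric], rule integral_cong_orthogonal)
       (simp add: sum_pow_entry_diag)
  also have "\<dots> = (\<Sum>j\<in>UNIV. \<integral>T. g T * q k j j T \<partial>H)"
    by (simp add: sum_distrib_left Bochner_Integration.integral_sum integrable_continuous continuous_intros g)
  also have "\<dots> = (\<Sum>j\<in>S. \<integral>T. g T * q k j j T \<partial>H) + (\<Sum>j\<in>-S. \<integral>T. g T * q k j j T \<partial>H)"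
    by (subst Compl_eq_Diff_UNIV, subst add.commute, rule sum.subset_diff) auto
  also have "(\<Sum>j\<in>-S. \<integral>T. g T * q k j j T \<partial>H) = real (card (- S)) * (\<integral>T. g T * q k c c T \<partial>H)"
    by (subst sum.cong[OF refl eq]) auto
  also have "real (card (- S)) = real CARD('m) - card S"
    by (simp add: Compl_eq_Diff_UNIV card_Diff_subset of_nat_diff card_mono)
  finally show ?thesis
    by simp
qed

end

subsection \<open>Moments of the diagonal entries\<close>

lemma (in haar_spectrum) integral_diag: "CARD('m) * (\<integral>T. q k a a T \<partial>H) = (\<Sum>c\<in>UNIV. lam $ c ^ k)"
  using integral_row_identity[of a a 0 k 0] by (simp add: prob_space)

locale centered_haar_spectrum = haar_spectrum H lam
  for H :: "(real^'m^'m) measure" and lam +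
  assumes centered: "(\<Sum>c\<in>UNIV. lam $ c) = 0"
begin

abbreviation "ps k \<equiv> \<Sum>c\<in>UNIV. lam $ c ^ k"
abbreviation "X a \<equiv> q 1 a a"

lemma power_sum_1: "ps 1 = 0" "(\<Sum>c\<in>UNIV. lam $ c ^ Suc 0) = 0"
  using centered by simp_all

lemma card_pos: "0 < CARD('m)"
  by simp

lemma integral_X: "(\<integral>T. X a T \<partial>H) = 0"
  using integral_diag[of 1 a] by (simp add: centered)

text \<open>The row recurrence trades a factor \<open>X a\<close> for a higher matrix power, so its
  repeated use ends in a deterministic trace. The same moment occurs in it with coefficients
  \<open>CARD('m)\<close> and \<open>2 * \<alpha>\<close>, whence the factor
  \<open>CARD('m) + 2\<close> here and \<open>CARD('m) + 4\<close>, \<open>CARD('m) + 6\<close>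
  below.\<close>

lemma integral_diag_X: "CARD('m) * (real CARD('m) + 2) * (\<integral>T. q k a a T * X a T \<partial>H) = 2 * ps (k + 1)"
proof -
  have "(real CARD('m) + 2) * (\<integral>T. q k a a T * X a T \<partial>H) = 2 * (\<integral>T. q (k + 1) a a T \<partial>H)"
    using integral_row_identity[of a a 0 k 1] integral_X[of a] by (simp add: algebra_simps)
  from arg_cong[OF this, of "\<lambda>x. CARD('m) * x"] show ?thesis
    using integral_diag[of "k + 1" a] by (simp add: algebra_simps)
qed

lemma integral_X2: "CARD('m) * (real CARD('m) + 2) * (\<integral>T. X a T * X a T \<partial>H) = 2 * ps 2"
  using integral_diag_X[of 1 a] by (simp add: eval_nat_numeral)

lemma integral_diag_X2:
  "CARD('m) * (real CARD('m) + 2) * (real CARD('m) + 4) * (\<integral>T. q k a a T * (X a T * X a T) \<partial>H) = 2 * ps k * ps 2 + 8 * ps (k + 2)"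
proof -
  have "(real CARD('m) + 4) * (\<integral>T. q k a a T * (X a T * X a T) \<partial>H)
      = ps k * (\<integral>T. X a T * X a T \<partial>H) + 4 * (\<integral>T. q (k + 1) a a T * X a T \<partial>H)"
    using integral_row_identity[of a a 0 k 2] by (simp add: power2_eq_square algebra_simps)
  from arg_cong[OF this, of "\<lambda>x. CARD('m) * (real CARD('m) + 2) * x"] show ?thesis
    using arg_cong[OF integral_X2[of a], of "\<lambda>x. ps k * x"] integral_diag_X[of "k + 1" a]
    by (simp add: algebra_simps eval_nat_numeral)
qed

lemma integral_X3: "CARD('m) * (real CARD('m) + 2) * (real CARD('m) + 4) * (\<integral>T. X a T * (X a T * X a T) \<partial>H) = 8 * ps 3"
  using integral_diag_X2[of 1 a] by (simp add: centered eval_nat_numeral)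

lemma integral_X4:
  "CARD('m) * (real CARD('m) + 2) * (real CARD('m) + 4) * (real CARD('m) + 6) * (\<integral>T. X a T * (X a T * (X a T * X a T)) \<partial>H)
     = 12 * (ps 2)\<^sup>2 + 48 * ps 4"
proof -
  have "(real CARD('m) + 6) * (\<integral>T. X a T * (X a T * (X a T * X a T)) \<partial>H) = 6 * (\<integral>T. q 2 a a T * (X a T * X a T) \<partial>H)"
    \<comment> \<open>With \<open>k = 1\<close> the trace term drops out, and only the matrix square
      remains on the right.\<close>
    using integral_row_identity[of a a 0 1 3] by (simp add: eval_nat_numeral centered algebra_simps)
  from arg_cong[OF this, of "\<lambda>x. CARD('m) * (real CARD('m) + 2) * (real CARD('m) + 4) * x"] show ?thesis
    using integral_diag_X2[of 2 a] by (simp add: algebra_simps eval_nat_numeral)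
qed

text \<open>The index \<open>b\<close> occurs once, so it can be summed out by tr X = 0: row
  \<open>a\<close> contributes the square, and all other rows contribute equally. The same argument
  gives \<open>integral_X2X\<close>, \<open>integral_XXX\<close>, \<open>integral_X3X\<close>,
  \<open>integral_X2XX\<close> and \<open>integral_XXXX\<close>.\<close>

lemma integral_XX:
  assumes "a \<noteq> b"
  shows "(real CARD('m) - 1) * (\<integral>T. X a T * X b T \<partial>H) = - (\<integral>T. X a T * X a T \<partial>H)"
  using integral_trace_identity[of "X a" b "{a}" 1] assms
  by (auto simp: power_sum_1 centered pow_entry_swap_rows continuous_intros)

lemma integral_X2X:
  assumes "a \<noteq> b"
  shows "(real CARD('m) - 1) * (\<integral>T. X a T * (X a T * X b T) \<partial>H) = - (\<integral>T. X a T * (X a T * X a T) \<partial>H)"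
  using integral_trace_identity[of "\<lambda>T. X a T * X a T" b "{a}" 1] assms
  by (auto simp: power_sum_1 centered pow_entry_swap_rows continuous_intros mult_ac)

lemma integral_XXX:
  assumes "a \<noteq> b" "a \<noteq> c" "b \<noteq> c"
  shows "(real CARD('m) - 2) * (\<integral>T. X a T * (X b T * X c T) \<partial>H)
     = - (\<integral>T. X a T * (X a T * X b T) \<partial>H) - (\<integral>T. X b T * (X b T * X a T) \<partial>H)"
proof -
  have "X a (swap_rows c x T) * X b (swap_rows c x T) = X a T * X b T" if "x \<notin> {a, b}" for x T
    using assms that by (auto simp: pow_entry_swap_rows)
  then show ?thesis
    using integral_trace_identity[of "\<lambda>T. X a T * X b T" c "{a, b}" 1] assms
    by (simp add: power_sum_1 centered continuous_intros mult_ac)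
qed

lemma integral_X3X:
  assumes "a \<noteq> b"
  shows "(real CARD('m) - 1) * (\<integral>T. X a T * (X a T * (X a T * X b T)) \<partial>H) = - (\<integral>T. X a T * (X a T * (X a T * X a T)) \<partial>H)"
  using integral_trace_identity[of "\<lambda>T. X a T * (X a T * X a T)" b "{a}" 1] assms
  by (auto simp: power_sum_1 centered pow_entry_swap_rows continuous_intros mult_ac)

lemma integral_X2XX:
  assumes "a \<noteq> b" "a \<noteq> c" "b \<noteq> c"
  shows "(real CARD('m) - 2) * (\<integral>T. X a T * (X a T * (X b T * X c T)) \<partial>H)
     = - (\<integral>T. X a T * (X a T * (X a T * X b T)) \<partial>H) - (\<integral>T. X a T * (X a T * (X b T * X b T)) \<partial>H)"
proof -
  have "X a (swap_rows c x T) * (X a (swap_rows c x T) * X b (swap_rows c x T)) = X a T * (X a T * X b T)" if "x \<notin> {a, b}" for x T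
    using assms that by (auto simp: pow_entry_swap_rows)
  then show ?thesis
    using integral_trace_identity[of "\<lambda>T. X a T * (X a T * X b T)" c "{a, b}" 1] assms
    by (simp add: power_sum_1 centered continuous_intros mult_ac)
qed

lemma integral_XXXX:
  assumes "a \<noteq> b" "a \<noteq> c" "b \<noteq> c" "a \<noteq> e" "b \<noteq> e" "c \<noteq> e"
  shows "(real CARD('m) - 3) * (\<integral>T. X a T * (X b T * (X c T * X e T)) \<partial>H)
     = - (\<integral>T. X a T * (X a T * (X b T * X c T)) \<partial>H) - (\<integral>T. X b T * (X b T * (X a T * X c T)) \<partial>H)
       - (\<integral>T. X c T * (X c T * (X a T * X b T)) \<partial>H)"
proof -
  have "X a (swap_rows e x T) * (X b (swap_rows e x T) * X c (swap_rows e x T)) = X a T * (X b T * X c T)" if "x \<notin> {a, b, c}" for x T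
    using assms that by (auto simp: pow_entry_swap_rows)
  then show ?thesis
    using integral_trace_identity[of "\<lambda>T. X a T * (X b T * X c T)" e "{a, b, c}" 1] assms
    by (simp add: power_sum_1 centered continuous_intros mult_ac)
qed

text \<open>The row identity for \<open>X\<^sub>a X\<^sub>b\<^sup>2\<close> leaves the moment of
  \<open>X\<^sub>a\<^sub>b\<^sup>2 X\<^sub>a X\<^sub>b\<close>. The pair identity with exponents 1
  and 2 reduces it to that of \<open>X\<^sub>a\<^sub>b\<^sup>2 X\<^sub>b\<^sup>2\<close>, and the
  pair identity with exponents 3 and 0 expresses the latter by diagonal moments.\<close>

lemma integral_X2X2:
  assumes "a \<noteq> b"
  shows "(real CARD('m) + 1) * (\<integral>T. X a T * (X a T * (X b T * X b T)) \<partial>H)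
     = 2 * (\<integral>T. q 2 a a T * (X b T * X b T) \<partial>H)
       - ((\<integral>T. X a T * (X a T * (X a T * X a T)) \<partial>H) + 2 * (\<integral>T. X b T * (X b T * (X b T * X a T)) \<partial>H)) / 3"
proof -
  \<comment> \<open>The elimination produces the fourth moment of \<open>X b\<close>, whereas the
    claim has that of \<open>X a\<close>; \<open>integral_X4\<close> determines both by the same
    value.\<close>
  have A: "CARD('m) * (real CARD('m) + 2) * (real CARD('m) + 4) * (real CARD('m) + 6) * ((\<integral>T. X a T * (X a T * (X a T * X a T)) \<partial>H) - (\<integral>T. X b T * (X b T * (X b T * X b T)) \<partial>H)) = 0"
    using integral_X4[of a] integral_X4[of b] by (simp add: right_diff_distrib)
  have A: "(\<integral>T. X a T * (X a T * (X a T * X a T)) \<partial>H) = (\<integral>T. X b T * (X b T * (X b T * X b T)) \<partial>H)"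
    using A card_pos by simp
  show ?thesis
    using integral_row_identity[of a b 2 1 1] integral_pair_identity_split[OF assms, of 1 1 2]
      integral_pair_identity_split[OF assms[symmetric], of 1 3 0] A assms
    by (simp add: centered pow_entry_commute[of lam 1 b a] pow_entry_commute[of lam "Suc 0" b a] eval_nat_numeral field_simps)
qed

text \<open>The summation now runs over the diagonal of the matrix square, whose trace
  \<open>ps 2\<close> is deterministic but not zero in general.\<close>

lemma integral_diag2_X2:
  assumes "a \<noteq> b"
  shows "(real CARD('m) - 1) * (\<integral>T. q 2 a a T * (X b T * X b T) \<partial>H)
     = ps 2 * (\<integral>T. X b T * X b T \<partial>H) - (\<integral>T. q 2 b b T * (X b T * X b T) \<partial>H)"
  using integral_trace_identity[of "\<lambda>T. X b T * X b T" a "{b}" 2] assms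
  by (auto simp: power_sum_1 centered pow_entry_swap_rows continuous_intros mult_ac)

end

subsection \<open>Moments of linear statistics of the diagonal\<close>

text \<open>
  A symmetric array is a combination of products of Kronecker deltas, one for each set partition
  of the index positions.  As \<open>v\<close> sums to zero, partitions with a singleton block contribute nothing.
\<close>

lemma symmetric_sum2:
  fixes M :: "'a::finite \<Rightarrow> 'a \<Rightarrow> real"
  assumes v: "(\<Sum>i\<in>UNIV. v i) = 0"
    and M: "\<And>i. M i i = A" "\<And>i j. i \<noteq> j \<Longrightarrow> M i j = B"
  shows "(\<Sum>i\<in>UNIV. v i * (\<Sum>j\<in>UNIV. v j * M i j)) = (A - B) * (\<Sum>i\<in>UNIV. (v i)\<^sup>2)"
proof -
  have "M i j = (A - B) * (if i = j then 1 else 0) + B" for i j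
    by (simp add: M)
  then have "(\<Sum>j\<in>UNIV. v j * M i j) = (A - B) * v i" for i
    by (simp add: distrib_left sum.distrib if_distrib[of "\<lambda>x. _ * x"] v cong: if_cong
        flip: sum_distrib_right)
  then show ?thesis
    by (simp add: sum_distrib_left power2_eq_square mult_ac)
qed

lemma symmetric_sum3:
  fixes M :: "'a::finite \<Rightarrow> 'a \<Rightarrow> 'a \<Rightarrow> real"
  assumes v: "(\<Sum>i\<in>UNIV. v i) = 0"
    and sym: "\<And>i j k. M i j k = M j i k" "\<And>i j k. M i j k = M i k j"
    and M: "\<And>i. M i i i = A" "\<And>i j. i \<noteq> j \<Longrightarrow> M i i j = B"
      "\<And>i j k. i \<noteq> j \<Longrightarrow> i \<noteq> k \<Longrightarrow> j \<noteq> k \<Longrightarrow> M i j k = D"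
  shows "(\<Sum>i\<in>UNIV. v i * (\<Sum>j\<in>UNIV. v j * (\<Sum>k\<in>UNIV. v k * M i j k)))
    = (A - 3 * B + 2 * D) * (\<Sum>i\<in>UNIV. v i ^ 3)"
proof -
  define \<delta> :: "'a \<Rightarrow> 'a \<Rightarrow> real" where "\<delta> i j = (if i = j then 1 else 0)" for i j
  define \<alpha> \<beta> where abc: "\<alpha> = A - 3 * B + 2 * D" "\<beta> = B - D"
  have d: "(\<Sum>j\<in>UNIV. v j * (c * \<delta> i j)) = c * v i" "(\<Sum>j\<in>UNIV. v j * (c * v j * \<delta> i j)) = c * (v i)\<^sup>2"
    "(\<Sum>j\<in>UNIV. v j * c) = 0" for c i
    by (simp_all add: \<delta>_def if_distrib[of "\<lambda>x. _ * x"] v power2_eq_square cong: if_cong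
        flip: sum_distrib_right)
  have B: "i \<noteq> j \<Longrightarrow> M i j i = B" "i \<noteq> j \<Longrightarrow> M j i i = B" for i j
    using M(2) sym by metis+
  have "M i j k = \<alpha> * \<delta> i j * \<delta> j k + \<beta> * \<delta> i j + \<beta> * \<delta> i k + \<beta> * \<delta> j k + D" for i j k
    by (cases "i = j"; cases "i = k"; cases "j = k") (simp_all add: \<delta>_def abc M B)
  then have "(\<Sum>k\<in>UNIV. v k * M i j k) = \<alpha> * v j * \<delta> i j + \<beta> * v i + \<beta> * v j" for i j
    by (simp only: distrib_left sum.distrib d) (simp add: algebra_simps)
  then have "(\<Sum>j\<in>UNIV. v j * (\<Sum>k\<in>UNIV. v k * M i j k))
      = \<alpha> * (v i)\<^sup>2 + \<beta> * (\<Sum>j\<in>UNIV. (v j)\<^sup>2)" for i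
    by (simp only: distrib_left sum.distrib d)
       (simp add: sum_distrib_left power2_eq_square mult_ac)
  then show ?thesis
    unfolding abc(1)[symmetric]
    by (simp only: distrib_left sum.distrib d)
       (simp add: sum_distrib_left power2_eq_square power3_eq_cube mult_ac)
qed

lemma symmetric_sum4:
  fixes M :: "'a::finite \<Rightarrow> 'a \<Rightarrow> 'a \<Rightarrow> 'a \<Rightarrow> real"
  assumes v: "(\<Sum>i\<in>UNIV. v i) = 0"
    and sym: "\<And>i j k l. M i j k l = M j i k l" "\<And>i j k l. M i j k l = M i k j l" "\<And>i j k l. M i j k l = M i j l k"
    and M: "\<And>i. M i i i i = A" "\<And>i j. i \<noteq> j \<Longrightarrow> M i i i j = B" "\<And>i j. i \<noteq> j \<Longrightarrow> M i i j j = C"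
      "\<And>i j k. i \<noteq> j \<Longrightarrow> i \<noteq> k \<Longrightarrow> j \<noteq> k \<Longrightarrow> M i i j k = D"
      "\<And>i j k l. distinct [i, j, k, l] \<Longrightarrow> M i j k l = E"
  shows "(\<Sum>i\<in>UNIV. v i * (\<Sum>j\<in>UNIV. v j * (\<Sum>k\<in>UNIV. v k * (\<Sum>l\<in>UNIV. v l * M i j k l))))
    = (A - 4 * B - 3 * C + 12 * D - 6 * E) * (\<Sum>i\<in>UNIV. v i ^ 4) + 3 * (C - 2 * D + E) * (\<Sum>i\<in>UNIV. (v i)\<^sup>2)\<^sup>2"
proof -
  define \<delta> :: "'a \<Rightarrow> 'a \<Rightarrow> real" where "\<delta> i j = (if i = j then 1 else 0)" for i j
  \<comment> \<open>Moebius inversion on the set partitions of four positions: in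
    \<open>\<alpha>\<close> the finest partition has weight -6, each of the six partitions with a
    single pair has weight 2, and the types 3+1 and 2+2 have weight -1. \<open>\<beta>\<close> and
    \<open>\<epsilon>\<close> belong to partitions with a singleton block and drop out at the
    end.\<close>
  define \<alpha> \<beta> \<gamma> \<epsilon> where abc: "\<alpha> = A - 4 * B - 3 * C + 12 * D - 6 * E" "\<beta> = B - 3 * D + 2 * E"
    "\<gamma> = C - 2 * D + E" "\<epsilon> = D - E"
  define p2 p3 where p: "p2 = (\<Sum>j\<in>UNIV. v j * v j)" "p3 = (\<Sum>j\<in>UNIV. v j * v j * v j)"
  have d: "(\<Sum>j\<in>UNIV. v j * (c * \<delta> i j)) = c * v i" "(\<Sum>j\<in>UNIV. v j * (c * v j * \<delta> i j)) = c * v i * v i"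
    "(\<Sum>j\<in>UNIV. v j * (c * v j * v j * \<delta> i j)) = c * v i * v i * v i"
    "(\<Sum>j\<in>UNIV. v j * c) = 0" "(\<Sum>j\<in>UNIV. v j * (c * v j)) = c * p2" "(\<Sum>j\<in>UNIV. v j * (c * v j * v j)) = c * p3" for c i
    by (simp_all add: \<delta>_def p if_distrib[of "\<lambda>x. _ * x"] v cong: if_cong
        flip: sum_distrib_right) (simp_all add: sum_distrib_left mult_ac)
  have M2: "i \<noteq> j \<Longrightarrow> M i i j i = B" "i \<noteq> j \<Longrightarrow> M i j i i = B" "i \<noteq> j \<Longrightarrow> M j i i i = B"
    "i \<noteq> j \<Longrightarrow> M i j i j = C" "i \<noteq> j \<Longrightarrow> M i j j i = C" for i j
    using M(2,3) sym by metis+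
  have M3: "M i j i k = D" "M i j k i = D" "M j i i k = D" "M j i k i = D" "M j k i i = D"
    if "i \<noteq> j" "i \<noteq> k" "j \<noteq> k" for i j k
    using M(4)[OF that] sym by metis+
  have "M i j k l = \<alpha> * \<delta> i j * \<delta> j k * \<delta> k l
      + \<beta> * \<delta> i j * \<delta> j k + \<beta> * \<delta> i j * \<delta> j l + \<beta> * \<delta> i k * \<delta> k l + \<beta> * \<delta> j k * \<delta> k l
      + \<gamma> * \<delta> i j * \<delta> k l + \<gamma> * \<delta> i k * \<delta> j l + \<gamma> * \<delta> j k * \<delta> i l
      + \<epsilon> * \<delta> i j + \<epsilon> * \<delta> i k + \<epsilon> * \<delta> i l + \<epsilon> * \<delta> j k + \<epsilon> * \<delta> j l + \<epsilon> * \<delta> k l + E" for i j k l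
    by (cases "i = j"; cases "i = k"; cases "i = l"; cases "j = k"; cases "j = l"; cases "k = l")
       (simp_all add: \<delta>_def abc M M2 M3)
  then have 1: "(\<Sum>l\<in>UNIV. v l * M i j k l) = \<alpha> * v k * \<delta> i j * \<delta> j k
      + \<beta> * v j * \<delta> i j + \<beta> * v k * \<delta> i k + \<beta> * v k * \<delta> j k
      + \<gamma> * \<delta> i j * v k + \<gamma> * v j * \<delta> i k + \<gamma> * v i * \<delta> j k + \<epsilon> * (v i + v j) + \<epsilon> * v k" for i j k
    by (simp only: distrib_left sum.distrib d) (simp add: algebra_simps)
  have 2: "(\<Sum>k\<in>UNIV. v k * (\<Sum>l\<in>UNIV. v l * M i j k l)) = \<alpha> * v j * v j * \<delta> i j
      + \<beta> * v i * v i + \<beta> * v j * v j + \<gamma> * p2 * \<delta> i j + 2 * \<gamma> * v i * v j + \<epsilon> * p2" for i j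
  proof -
    \<comment> \<open>Regrouped so that the leading term matches the pattern
      \<open>c * v k * \<delta> j k\<close> of \<open>d\<close>, with
      \<open>c = \<alpha> * \<delta> i j\<close>.\<close>
    have "(\<Sum>l\<in>UNIV. v l * M i j k l) = (\<alpha> * \<delta> i j) * v k * \<delta> j k
      + \<beta> * v j * \<delta> i j + \<beta> * v k * \<delta> i k + \<beta> * v k * \<delta> j k
      + \<gamma> * \<delta> i j * v k + \<gamma> * v j * \<delta> i k + \<gamma> * v i * \<delta> j k + \<epsilon> * (v i + v j) + \<epsilon> * v k" for k
      unfolding 1 by simp
    then show ?thesis
      by (simp only: distrib_left[of "v _"] sum.distrib d) (simp add: algebra_simps)
  qed
  have 3: "(\<Sum>j\<in>UNIV. v j * (\<Sum>k\<in>UNIV. v k * (\<Sum>l\<in>UNIV. v l * M i j k l)))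
      = \<alpha> * v i * v i * v i + 3 * \<gamma> * p2 * v i + \<beta> * p3" for i
    by (simp only: 2 distrib_left[of "v _"] sum.distrib d) (simp add: algebra_simps)
  have "(\<Sum>i\<in>UNIV. v i * (\<Sum>j\<in>UNIV. v j * (\<Sum>k\<in>UNIV. v k * (\<Sum>l\<in>UNIV. v l * M i j k l))))
      = \<alpha> * (\<Sum>i\<in>UNIV. v i * v i * v i * v i) + 3 * \<gamma> * p2 * p2"
    by (simp only: 3 distrib_left[of "v _"] sum.distrib d) (simp add: sum_distrib_left algebra_simps)
  then show ?thesis
    by (simp add: abc p power2_eq_square power4_eq_xxxx)
qed

section \<open>Algebraic elimination of the mixed moments\<close>

lemma mult_imp_eq_divide: "k * x = y \<Longrightarrow> k \<noteq> 0 \<Longrightarrow> x = y / k" for k x y :: real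
  by (simp add: eq_divide_eq mult.commute)

lemma second_moment_identity:
  fixes d p :: real
  assumes "d * (d + 2) * A = 2 * p" "(d - 1) * B = - A"
  shows "(d - 1) * (d + 2) * (A - B) = 2 * p"
  using assms by algebra

lemma third_moment_identity:
  fixes d p :: real
  assumes "d * (d + 2) * (d + 4) * A = 8 * p" "(d - 1) * B = - A" "(d - 2) * D = - 2 * B"
  shows "(d - 2) * (d - 1) * (d + 2) * (d + 4) * (A - 3 * B + 2 * D) = 8 * d * p"
  using assms by algebra

text \<open>
  With distinct indices, \<open>A\<close>, \<open>B\<close>, \<open>C\<close>, \<open>D\<close>, \<open>E\<close> are the moments of \<open>X\<^sub>i\<^sup>4\<close>, \<open>X\<^sub>i\<^sup>3 X\<^sub>j\<close>,
  \<open>X\<^sub>i\<^sup>2 X\<^sub>j\<^sup>2\<close>, \<open>X\<^sub>i\<^sup>2 X\<^sub>j X\<^sub>k\<close>, \<open>X\<^sub>i X\<^sub>j X\<^sub>k X\<^sub>l\<close> for the diagonal entries of \<open>X\<close>; \<open>F\<close> is that of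
  \<open>X\<^sub>i\<^sup>2\<close>, and \<open>G\<close> and \<open>c\<close> are those of a diagonal entry of the matrix square times \<open>X\<^sub>i\<^sup>2\<close>, with
  equal and with different indices respectively.
\<close>

lemma fourth_moment_identity:
  fixes d p2 p4 r2 r4 :: real
  assumes d: "3 < d"
    and A: "d * (d + 2) * (d + 4) * (d + 6) * A = 12 * p2\<^sup>2 + 48 * p4"
    and F: "d * (d + 2) * F = 2 * p2"
    and G: "d * (d + 2) * (d + 4) * G = 2 * p2 * p2 + 8 * p4"
    and B: "(d - 1) * B = - A"
    and c: "(d - 1) * c = p2 * F - G"
    and C: "(d + 1) * C = 2 * c - (A + 2 * B) / 3"
    and D: "(d - 2) * D = - B - C"
    and E: "(d - 3) * E = - 3 * D"
  shows "(A - 4 * B - 3 * C + 12 * D - 6 * E) * r4 + 3 * (C - 2 * D + E) * r2\<^sup>2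
    = 12 * d ^ 3 / ((d - 3) * (d - 2) * (d - 1) * (d + 1) * (d + 2) * (d + 4) * (d + 6)) *
      (4 * ((d + 1)\<^sup>2 - (d + 1) + 2) * (p4 / d) * (r4 / d)
       + ((d + 1) ^ 4 + (d + 1) ^ 3 - 15 * (d + 1)\<^sup>2 - 13 * (d + 1) + 98) * (p2 / d)\<^sup>2 * (r2 / d)\<^sup>2
       - 4 * (2 * (d + 1)\<^sup>2 - (d + 1) - 7) * (p4 / d * (r2 / d)\<^sup>2 + (p2 / d)\<^sup>2 * (r4 / d)))"
    (is "?lhs = ?rhs")
proof -
  \<comment> \<open>Numerators after clearing denominators: \<open>w\<close> is that of
    \<open>G\<close>, \<open>6 * w\<close> that of \<open>A\<close>, and \<open>z\<close> that of
    \<open>C\<close> once \<open>A\<close>, \<open>B\<close> and \<open>c\<close> have been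
    substituted.\<close>
  define w where "w = 2 * p2\<^sup>2 + 8 * p4"
  define \<Delta> where "\<Delta> = d * (d + 2) * (d + 4) * (d + 6)"
  define z where "z = 4 * p2\<^sup>2 * (d + 4) * (d + 6) - (4 * d + 6) * w"
  have nz: "d \<noteq> 0" "d + 2 \<noteq> 0" "d + 4 \<noteq> 0" "d + 6 \<noteq> 0" "d - 1 \<noteq> 0" "d + 1 \<noteq> 0" "d - 2 \<noteq> 0" "d - 3 \<noteq> 0"
    using d by auto
  have A': "\<Delta> * A = 6 * w"
    using A by (simp add: \<Delta>_def w_def)
  have B': "\<Delta> * (d - 1) * B = - 6 * w"
    using A' B by algebra
  have c': "\<Delta> * (d - 1) * c = 2 * p2\<^sup>2 * (d + 4) * (d + 6) - (d + 6) * w"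
    using c F G unfolding \<Delta>_def w_def by algebra
  have "3 * ((d + 1) * C) = 6 * c - (A + 2 * B)"
    unfolding C by (simp add: field_simps)
  then have C': "\<Delta> * (d - 1) * (d + 1) * C = z"
    using A' B' c' unfolding z_def by algebra
  have D': "\<Delta> * (d - 1) * (d + 1) * (d - 2) * D = 6 * w * (d + 1) - z"
    using D B' C' by algebra
  have E': "\<Delta> * (d - 1) * (d + 1) * (d - 2) * (d - 3) * E = - 3 * (6 * w * (d + 1) - z)"
    using E D' by algebra
  \<comment> \<open>A common denominator of the five moments. Its factor \<open>d\<close>, together
    with \<open>d ^ 3\<close> in the claim, absorbs the divisions of the power sums by
    \<open>d\<close>.\<close>
  define K where "K = \<Delta> * (d - 1) * (d + 1) * (d - 2) * (d - 3)"
  have "K * ?lhs = (6 * w * (d - 1) * (d + 1) * (d - 2) * (d - 3)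
        + 24 * w * (d + 1) * (d - 2) * (d - 3) - 3 * z * (d - 2) * (d - 3)
        + 12 * (d - 3) * (6 * w * (d + 1) - z) + 18 * (6 * w * (d + 1) - z)) * r4
      + 3 * (z * (d - 2) * (d - 3) - 2 * (d - 3) * (6 * w * (d + 1) - z) - 3 * (6 * w * (d + 1) - z)) * r2\<^sup>2"
    using A' B' C' D' E' unfolding K_def by algebra
  also have "\<dots> = 12 * (4 * ((d + 1)\<^sup>2 - (d + 1) + 2) * p4 * r4 * d\<^sup>2
       + ((d + 1) ^ 4 + (d + 1) ^ 3 - 15 * (d + 1)\<^sup>2 - 13 * (d + 1) + 98) * p2\<^sup>2 * r2\<^sup>2
       - 4 * (2 * (d + 1)\<^sup>2 - (d + 1) - 7) * (p4 * r2\<^sup>2 + p2\<^sup>2 * r4) * d)"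
    unfolding z_def w_def by algebra
  also have "\<dots> = K * ?rhs"
    using nz unfolding K_def \<Delta>_def
    by (simp add: divide_simps) (simp add: eval_nat_numeral algebra_simps)
  finally have "K * ?lhs = K * ?rhs" .
  moreover have "K \<noteq> 0"
    using nz by (simp add: K_def \<Delta>_def)
  ultimately show ?thesis
    unfolding mult_left_cancel[OF \<open>K \<noteq> 0\<close>] by blast
qed

definition diag_form :: "real^'m \<Rightarrow> real^'m \<Rightarrow> real^'m^'m \<Rightarrow> real" where
  "diag_form lam v T = (\<Sum>i\<in>UNIV. v $ i * pow_entry lam 1 i i T)"

lemma continuous_on_diag_form [continuous_intros]: "continuous_on A (diag_form lam v)"
  unfolding diag_form_def by (intro continuous_intros)

context centered_haar_spectrum
begin

context
  fixes v :: "real^'m"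
  assumes v: "(\<Sum>i\<in>UNIV. v $ i) = 0"
begin

abbreviation "S \<equiv> diag_form lam v"

text \<open>Peels off one factor \<open>S\<close>; iteration turns a moment of \<open>S\<close> into
  the nested sums evaluated by \<open>symmetric_sum2\<close>, \<open>symmetric_sum3\<close> and
  \<open>symmetric_sum4\<close>.\<close>

lemma integral_S_mult:
  "continuous_on UNIV g \<Longrightarrow> (\<integral>T. S T * g T \<partial>H) = (\<Sum>i\<in>UNIV. v $ i * (\<integral>T. X i T * g T \<partial>H))"
  by (simp add: diag_form_def sum_distrib_right mult.assoc Bochner_Integration.integral_sum
      integrable_continuous continuous_intros)

lemma integral_S: "(\<integral>T. S T \<partial>H) = 0"
  using integral_S_mult[of "\<lambda>_. 1"] integral_X by simp

lemma integral_S2: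
  assumes "2 \<le> CARD('m)"
  shows "(real CARD('m) - 1) * (real CARD('m) + 2) * (\<integral>T. S T ^ 2 \<partial>H) = 2 * ps 2 * (\<Sum>i\<in>UNIV. (v $ i)\<^sup>2)"
proof -
  define A where "A = 2 * ps 2 / (CARD('m) * (real CARD('m) + 2))"
  define B where "B = - A / (real CARD('m) - 1)"
  have d: "real CARD('m) - 1 > 0"
    using assms by simp
  have A: "(\<integral>T. X i T * X i T \<partial>H) = A" for i
    using mult_imp_eq_divide[OF integral_X2[of i]] by (simp add: A_def)
  have B: "(\<integral>T. X i T * X j T \<partial>H) = B" if "i \<noteq> j" for i j
    using integral_XX[OF that] d by (simp add: A B_def field_simps del: One_nat_def)
  have "(\<integral>T. S T ^ 2 \<partial>H) = (\<Sum>i\<in>UNIV. v $ i * (\<integral>T. S T * X i T \<partial>H))"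
    using integral_S_mult[of S] by (simp add: power2_eq_square continuous_intros mult_ac)
  also have "\<dots> = (\<Sum>i\<in>UNIV. v $ i * (\<Sum>j\<in>UNIV. v $ j * (\<integral>T. X i T * X j T \<partial>H)))"
    using integral_S_mult[of "X _"] by (simp add: continuous_intros mult_ac)
  also have "\<dots> = (A - B) * (\<Sum>i\<in>UNIV. (v $ i)\<^sup>2)"
    by (rule symmetric_sum2[OF v]) (auto simp: A B simp del: One_nat_def)
  finally have S: "(\<integral>T. S T ^ 2 \<partial>H) = (A - B) * (\<Sum>i\<in>UNIV. (v $ i)\<^sup>2)" .
  have "CARD('m) * (real CARD('m) + 2) * A = 2 * ps 2" "(real CARD('m) - 1) * B = - A"
    using d by (simp_all add: A_def B_def)
  from second_moment_identity[OF this] show ?thesis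
    unfolding S by simp
qed

lemma integral_S3:
  assumes "3 \<le> CARD('m)"
  shows "(real CARD('m) - 2) * (real CARD('m) - 1) * (real CARD('m) + 2) * (real CARD('m) + 4) * (\<integral>T. S T ^ 3 \<partial>H)
    = 8 * CARD('m) * ps 3 * (\<Sum>i\<in>UNIV. (v $ i) ^ 3)"
proof -
  define A where "A = 8 * ps 3 / (CARD('m) * (real CARD('m) + 2) * (real CARD('m) + 4))"
  define B where "B = - A / (real CARD('m) - 1)"
  define D where "D = - 2 * B / (real CARD('m) - 2)"
  have d: "real CARD('m) - 1 > 0" "real CARD('m) - 2 > 0"
    using assms by simp_all
  have A: "(\<integral>T. X i T * (X i T * X i T) \<partial>H) = A" for i
    using mult_imp_eq_divide[OF integral_X3[of i]] by (simp add: A_def)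
  have B: "(\<integral>T. X i T * (X i T * X j T) \<partial>H) = B" if "i \<noteq> j" for i j
    using integral_X2X[OF that] d by (simp add: A B_def field_simps del: One_nat_def)
  have D: "(\<integral>T. X i T * (X j T * X k T) \<partial>H) = D" if "i \<noteq> j" "i \<noteq> k" "j \<noteq> k" for i j k
    using integral_XXX[OF that] B[OF that(1)] B[OF that(1)[symmetric]] d by (simp add: D_def field_simps del: One_nat_def)
  have "(\<integral>T. S T ^ 3 \<partial>H) = (\<Sum>i\<in>UNIV. v $ i * (\<integral>T. S T * (S T * X i T) \<partial>H))"
    using integral_S_mult[of "\<lambda>T. S T * S T"] by (simp add: power3_eq_cube continuous_intros mult_ac)
  also have "\<dots> = (\<Sum>i\<in>UNIV. v $ i * (\<Sum>j\<in>UNIV. v $ j * (\<integral>T. S T * (X j T * X i T) \<partial>H)))"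
    using integral_S_mult[of "\<lambda>T. S T * X _ T"] by (simp add: continuous_intros mult_ac)
  also have "\<dots> = (\<Sum>i\<in>UNIV. v $ i * (\<Sum>j\<in>UNIV. v $ j * (\<Sum>k\<in>UNIV. v $ k * (\<integral>T. X i T * (X j T * X k T) \<partial>H))))"
    using integral_S_mult[of "\<lambda>T. X _ T * X _ T"] by (simp add: continuous_intros mult_ac)
  also have "\<dots> = (A - 3 * B + 2 * D) * (\<Sum>i\<in>UNIV. (v $ i) ^ 3)"
    by (rule symmetric_sum3[OF v]) (auto simp: A B D mult_ac simp del: One_nat_def)
  finally have S: "(\<integral>T. S T ^ 3 \<partial>H) = (A - 3 * B + 2 * D) * (\<Sum>i\<in>UNIV. (v $ i) ^ 3)" .
  have "CARD('m) * (real CARD('m) + 2) * (real CARD('m) + 4) * A = 8 * ps 3"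
    "(real CARD('m) - 1) * B = - A" "(real CARD('m) - 2) * D = - 2 * B"
    using d by (simp_all add: A_def B_def D_def)
  from third_moment_identity[OF this] show ?thesis
    unfolding S by simp
qed

lemma integral_S4:
  assumes "4 \<le> CARD('m)" and N: "N = real CARD('m) + 1"
  shows "(\<integral>T. S T ^ 4 \<partial>H)
    = 12 * (N - 1)^3 / ((N - 4) * (N - 3) * (N - 2) * N * (N + 1) * (N + 3) * (N + 5)) *
      (4 * (N^2 - N + 2) * (ps 4 / CARD('m)) * ((\<Sum>i\<in>UNIV. (v $ i) ^ 4) / CARD('m))
       + (N^4 + N^3 - 15 * N^2 - 13 * N + 98) * (ps 2 / CARD('m))\<^sup>2 * ((\<Sum>i\<in>UNIV. (v $ i)\<^sup>2) / CARD('m))\<^sup>2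
       - 4 * (2 * N^2 - N - 7) *
         (ps 4 / CARD('m) * ((\<Sum>i\<in>UNIV. (v $ i)\<^sup>2) / CARD('m))\<^sup>2
          + (ps 2 / CARD('m))\<^sup>2 * ((\<Sum>i\<in>UNIV. (v $ i) ^ 4) / CARD('m))))"
proof -
  define d where "d = real CARD('m)"
  \<comment> \<open>The recurrences are solved in order of dependency. Each value depends only on
    which indices coincide, as the symmetric sum requires.\<close>
  define A where "A = (12 * (ps 2)\<^sup>2 + 48 * ps 4) / (d * (d + 2) * (d + 4) * (d + 6))"
  define F where "F = 2 * ps 2 / (d * (d + 2))"
  define G where "G = (2 * ps 2 * ps 2 + 8 * ps 4) / (d * (d + 2) * (d + 4))"
  define B where "B = - A / (d - 1)"
  define c where "c = (ps 2 * F - G) / (d - 1)"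
  define C where "C = (2 * c - (A + 2 * B) / 3) / (d + 1)"
  define D where "D = (- B - C) / (d - 2)"
  define E where "E = - 3 * D / (d - 3)"
  have d: "d > 3"
    using assms by (simp add: d_def)
  have A: "(\<integral>T. X i T * (X i T * (X i T * X i T)) \<partial>H) = A" for i
    using mult_imp_eq_divide[OF integral_X4[of i]] d by (simp add: A_def d_def)
  have F: "(\<integral>T. X i T * X i T \<partial>H) = F" for i
    using mult_imp_eq_divide[OF integral_X2[of i]] d by (simp add: F_def d_def)
  have G: "(\<integral>T. q 2 i i T * (X i T * X i T) \<partial>H) = G" for i
    using mult_imp_eq_divide[OF integral_diag_X2[of 2 i]] d by (simp add: G_def d_def)
  have B: "(\<integral>T. X i T * (X i T * (X i T * X j T)) \<partial>H) = B" if "i \<noteq> j" for i j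
    using integral_X3X[OF that] d by (simp add: A B_def field_simps flip: d_def del: One_nat_def)
  have c: "(\<integral>T. q 2 i i T * (X j T * X j T) \<partial>H) = c" if "i \<noteq> j" for i j
    using integral_diag2_X2[OF that] F[of j] G[of j] d by (simp add: c_def field_simps flip: d_def del: One_nat_def)
  have C: "(\<integral>T. X i T * (X i T * (X j T * X j T)) \<partial>H) = C" if "i \<noteq> j" for i j
    using integral_X2X2[OF that] A[of i] B[OF that[symmetric]] c[OF that] d by (simp add: C_def field_simps flip: d_def del: One_nat_def)
  have D: "(\<integral>T. X i T * (X i T * (X j T * X k T)) \<partial>H) = D" if "i \<noteq> j" "i \<noteq> k" "j \<noteq> k" for i j k
    using integral_X2XX[OF that] B[OF that(1)] C[OF that(1)] d by (simp add: D_def field_simps flip: d_def del: One_nat_def)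
  have E: "(\<integral>T. X i T * (X j T * (X k T * X l T)) \<partial>H) = E"
    if "i \<noteq> j" "i \<noteq> k" "j \<noteq> k" "i \<noteq> l" "j \<noteq> l" "k \<noteq> l" for i j k l
    using integral_XXXX[OF that] D[of i j k] D[of j i k] D[of k i j] d that by (simp add: E_def field_simps flip: d_def del: One_nat_def)
  have "(\<integral>T. S T ^ 4 \<partial>H) = (\<Sum>i\<in>UNIV. v $ i * (\<integral>T. S T * (S T * (S T * X i T)) \<partial>H))"
    using integral_S_mult[of "\<lambda>T. S T * (S T * S T)"] by (simp add: power4_eq_xxxx continuous_intros mult_ac)
  also have "\<dots> = (\<Sum>i\<in>UNIV. v $ i * (\<Sum>j\<in>UNIV. v $ j * (\<integral>T. S T * (S T * (X j T * X i T)) \<partial>H)))"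
    using integral_S_mult[of "\<lambda>T. S T * (S T * X _ T)"] by (simp add: continuous_intros mult_ac)
  also have "\<dots> = (\<Sum>i\<in>UNIV. v $ i * (\<Sum>j\<in>UNIV. v $ j * (\<Sum>k\<in>UNIV. v $ k * (\<integral>T. S T * (X k T * (X j T * X i T)) \<partial>H))))"
    using integral_S_mult[of "\<lambda>T. S T * (X _ T * X _ T)"] by (simp add: continuous_intros mult_ac)
  also have "\<dots> = (\<Sum>i\<in>UNIV. v $ i * (\<Sum>j\<in>UNIV. v $ j * (\<Sum>k\<in>UNIV. v $ k *
      (\<Sum>l\<in>UNIV. v $ l * (\<integral>T. X i T * (X j T * (X k T * X l T)) \<partial>H)))))"
    using integral_S_mult[of "\<lambda>T. X _ T * (X _ T * X _ T)"] by (simp add: continuous_intros mult_ac)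
  also have "\<dots> = (A - 4 * B - 3 * C + 12 * D - 6 * E) * (\<Sum>i\<in>UNIV. v $ i ^ 4)
      + 3 * (C - 2 * D + E) * (\<Sum>i\<in>UNIV. (v $ i)\<^sup>2)\<^sup>2"
    by (rule symmetric_sum4[OF v]) (auto simp: A B C D E mult_ac simp del: One_nat_def)
  also have "\<dots> = 12 * d ^ 3 / ((d - 3) * (d - 2) * (d - 1) * (d + 1) * (d + 2) * (d + 4) * (d + 6)) *
      (4 * ((d + 1)\<^sup>2 - (d + 1) + 2) * (ps 4 / d) * ((\<Sum>i\<in>UNIV. v $ i ^ 4) / d)
       + ((d + 1) ^ 4 + (d + 1) ^ 3 - 15 * (d + 1)\<^sup>2 - 13 * (d + 1) + 98) * (ps 2 / d)\<^sup>2 * ((\<Sum>i\<in>UNIV. (v $ i)\<^sup>2) / d)\<^sup>2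
       - 4 * (2 * (d + 1)\<^sup>2 - (d + 1) - 7) * (ps 4 / d * ((\<Sum>i\<in>UNIV. (v $ i)\<^sup>2) / d)\<^sup>2 + (ps 2 / d)\<^sup>2 * ((\<Sum>i\<in>UNIV. v $ i ^ 4) / d)))"
    using d
    by (intro fourth_moment_identity[where F = F and G = G and c = c]) (auto simp: A_def F_def G_def B_def c_def C_def D_def E_def)
  finally show ?thesis
    by (simp add: N d_def add.commute)
qed

end

end

subsection \<open>The covariance of two kernels\<close>

lemma trace_mult_commute:
  fixes A :: "real^'m^'n" and B :: "real^'n^'m"
  shows "trace (A ** B) = trace (B ** A)"
  unfolding trace_def matrix_matrix_mult_def
  by (simp, subst sum.swap) (simp add: mult.commute)

lemma matrix_mult_diag_mat: "(A ** diag_mat v) $ i $ j = A $ i $ j * v $ j"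
  by (simp add: matrix_matrix_mult_def diag_mat_def if_distrib[of "\<lambda>x. _ * x"] cong: if_cong)

lemma trace_mult_diag_mat: "trace (A ** diag_mat v) = (\<Sum>i\<in>UNIV. A $ i $ i * v $ i)"
  by (simp add: trace_def matrix_mult_diag_mat)

lemma conjugate_diag_mat_entry:
  "(T ** diag_mat lam ** transpose T) $ i $ j = pow_entry lam 1 i j T"
  unfolding matrix_matrix_mult_def[of "T ** diag_mat lam"]
  by (simp add: matrix_mult_diag_mat transpose_def pow_entry_def mult_ac)

text \<open>Cyclicity of the trace carries \<open>transpose V\<close> to the front, so that the two
  bases enter only through \<open>transpose V ** U\<close>.\<close>

lemma CV_eq_diag_form: "CV U lam V mu T = diag_form lam mu (transpose V ** U ** T)"
proof -
  define W where "W = transpose V ** U ** T"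
  have "CV U lam V mu T
      = trace ((U ** T ** diag_mat lam ** transpose T ** transpose U ** V ** diag_mat mu) ** transpose V)"
    by (simp add: CV_def)
  also have "\<dots> = trace (transpose V ** (U ** T ** diag_mat lam ** transpose T ** transpose U ** V ** diag_mat mu))"
    by (rule trace_mult_commute)
  also have "\<dots> = trace (W ** diag_mat lam ** transpose W ** diag_mat mu)"
    by (simp add: W_def matrix_transpose_mul matrix_mul_assoc)
  also have "\<dots> = diag_form lam mu W"
    by (simp add: trace_mult_diag_mat conjugate_diag_mat_entry diag_form_def mult.commute)
  finally show ?thesis
    by (simp add: W_def)
qed

section \<open>Centring the spectra\<close>

definition centre :: "real^'m \<Rightarrow> real^'m" where
  "centre lam = (\<chi> i. lam $ i - spec_moment 1 lam)"

lemma sum_centre: "(\<Sum>i\<in>UNIV. centre lam $ i) = 0"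
  by (simp add: centre_def sum_subtractf spec_moment_def)

lemma sum_centre_power:
  fixes lam :: "real^'m"
  shows "(\<Sum>i\<in>UNIV. centre lam $ i ^ k) = CARD('m) * spec_cmoment k lam"
  by (simp add: centre_def spec_cmoment_def)

text \<open>Centring \<open>lam\<close> subtracts a multiple of the identity from X, because
  \<open>T\<close> is orthogonal. The cross terms vanish, since \<open>centre mu\<close> sums to
  zero and the centred X has trace zero. As the shift is constant, central moments of
  \<open>CV\<close> become raw moments of the centred form.\<close>

lemma diag_form_centre:
  fixes T :: "real^'m^'m"
  assumes "orthogonal_matrix T"
  shows "diag_form lam mu T = diag_form (centre lam) (centre mu) T + CARD('m) * spec_moment 1 lam * spec_moment 1 mu"
proof -
  have 1: "pow_entry lam 1 i i T = pow_entry (centre lam) 1 i i T + spec_moment 1 lam" for i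
    using orthogonal_matrix_rows[OF assms, of i i]
    by (simp add: pow_entry_def centre_def algebra_simps sum_subtractf flip: sum_distrib_left sum_distrib_right)
  have "(\<Sum>i\<in>UNIV. pow_entry (centre lam) 1 i i T) = (\<Sum>c\<in>UNIV. centre lam $ c)"
    unfolding pow_entry_def
    by (subst sum.swap) (simp add: orthogonal_matrix_columns[OF assms] mult.assoc flip: sum_distrib_left)
  then have 0: "(\<Sum>i\<in>UNIV. pow_entry (centre lam) 1 i i T) = 0"
    by (simp add: sum_centre)
  have "diag_form lam mu T = (\<Sum>i\<in>UNIV. (centre mu $ i + spec_moment 1 mu) * (pow_entry (centre lam) 1 i i T + spec_moment 1 lam))"
    by (simp only: diag_form_def 1) (simp add: centre_def)
  also have "\<dots> = diag_form (centre lam) (centre mu) T + spec_moment 1 lam * (\<Sum>i\<in>UNIV. centre mu $ i)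
      + spec_moment 1 mu * (\<Sum>i\<in>UNIV. pow_entry (centre lam) 1 i i T) + CARD('m) * spec_moment 1 lam * spec_moment 1 mu"
    by (simp add: diag_form_def algebra_simps sum.distrib sum_distrib_left)
  finally show ?thesis
    by (simp only: 0 sum_centre mult_zero_right add_0_right)
qed

lemma spectral_decomposition_traces:
  fixes K :: "real^'n^'n" and U :: "real^('m::{finite,linorder})^'n"
  assumes "spectral_decomposition f K U lam"
  shows "trace K = (\<Sum>i\<in>UNIV. lam $ i)" and "trace (K ** K) = (\<Sum>i\<in>UNIV. (lam $ i)\<^sup>2)"
    and "K \<noteq> 0 \<Longrightarrow> 0 < (\<Sum>i\<in>UNIV. (lam $ i)\<^sup>2)"
proof -
  have K: "K = U ** diag_mat lam ** transpose U" and U: "transpose U ** U = mat 1"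
    using assms by (auto simp: spectral_decomposition_def)
  have tr: "trace (U ** D ** transpose U) = trace D" for D
    using trace_mult_commute[of "U ** D" "transpose U"] U by (simp add: matrix_mul_assoc)
  show "trace K = (\<Sum>i\<in>UNIV. lam $ i)"
    unfolding K tr by (simp add: trace_def diag_mat_def)
  have "K ** K = U ** diag_mat lam ** (transpose U ** U) ** diag_mat lam ** transpose U"
    by (simp only: K matrix_mul_assoc)
  then have "K ** K = U ** (diag_mat lam ** diag_mat lam) ** transpose U"
    by (simp add: U matrix_mul_assoc)
  then show "trace (K ** K) = (\<Sum>i\<in>UNIV. (lam $ i)\<^sup>2)"
    by (simp add: tr trace_mult_diag_mat) (simp add: diag_mat_def power2_eq_square)
  assume "K \<noteq> 0"
  have "lam \<noteq> 0"
  proof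
    assume "lam = 0"
    then have "diag_mat lam = 0"
      by (simp add: diag_mat_def vec_eq_iff)
    then show False
      using \<open>K \<noteq> 0\<close> K by simp
  qed
  then obtain i where "lam $ i \<noteq> 0"
    by (auto simp: vec_eq_iff)
  then show "0 < (\<Sum>i\<in>UNIV. (lam $ i)\<^sup>2)"
    by (intro sum_pos2[of _ i]) auto
qed

text \<open>The common weight vector enters here: \<open>U ** transpose U\<close> and
  \<open>V ** transpose V\<close> are the same projection, onto the complement of
  \<open>sqrt_vec f\<close>.\<close>

lemma orthogonal_matrix_spectral_bases:
  fixes U V :: "real^('m::{finite,linorder})^'n"
  assumes "spectral_decomposition f KX U lam" "spectral_decomposition f KY V mu"
  shows "orthogonal_matrix (transpose V ** U)"
proof -
  have "transpose (transpose V ** U) ** (transpose V ** U) = transpose U ** (V ** transpose V) ** U"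
    by (simp add: matrix_transpose_mul matrix_mul_assoc)
  also have "V ** transpose V = U ** transpose U"
    using assms by (simp add: spectral_decomposition_def)
  also have "transpose U ** (U ** transpose U) ** U = (transpose U ** U) ** (transpose U ** U)"
    by (simp only: matrix_mul_assoc)
  also have "\<dots> = mat 1"
    using assms(1) by (simp add: spectral_decomposition_def)
  finally show ?thesis
    by (simp add: orthogonal_matrix)
qed

lemma spec_cmoment_2:
  fixes lam :: "real^'m"
  shows "spec_cmoment 2 lam = spec_moment 2 lam - (spec_moment 1 lam)\<^sup>2"
proof -
  have "(\<Sum>\<alpha>\<in>UNIV. (lam $ \<alpha> - spec_moment 1 lam)\<^sup>2)
      = (\<Sum>\<alpha>\<in>UNIV. (lam $ \<alpha>)\<^sup>2) - 2 * spec_moment 1 lam * (\<Sum>\<alpha>\<in>UNIV. lam $ \<alpha>) + CARD('m) * (spec_moment 1 lam)\<^sup>2"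
    by (simp add: power2_diff sum.distrib sum_subtractf sum_distrib_left mult_ac)
  also have "(\<Sum>\<alpha>\<in>UNIV. lam $ \<alpha>) = CARD('m) * spec_moment 1 lam"
    by (simp add: spec_moment_def)
  finally show ?thesis
    unfolding spec_cmoment_def spec_moment_def[of 2] by (simp add: field_simps power2_eq_square)
qed

context
  fixes H :: "(real^'m^'m) measure" and P :: "'w measure" and T :: "'w \<Rightarrow> real^'m^'m"
    and U V :: "real^'m^'n" and lam mu :: "real^'m"
  assumes H: "haar_orthogonal H"
    and T: "T \<in> P \<rightarrow>\<^sub>M H" "distr P H T = H"
    and Q: "orthogonal_matrix (transpose V ** U)"
begin

interpretation X: centered_haar_spectrum H "centre lam"
  by standard (auto simp: H sum_centre)

text \<open>The law of \<open>T\<close> moves the integral to \<open>H\<close>, left invariance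
  absorbs \<open>transpose V ** U\<close>, and centring does the rest. A general \<open>g\<close>
  serves the mean and all central moments alike.\<close>

lemma expectation_CV_comp:
  fixes g :: "real \<Rightarrow> real"
  assumes g: "continuous_on UNIV g"
  shows "(\<integral>\<omega>. g (CV U lam V mu (T \<omega>)) \<partial>P)
    = (\<integral>A. g (diag_form (centre lam) (centre mu) A + CARD('m) * spec_moment 1 lam * spec_moment 1 mu) \<partial>H)"
proof -
  have cont: "continuous_on UNIV (\<lambda>A. g (diag_form lam mu A))"
    by (rule continuous_on_compose2[OF g]) (auto intro!: continuous_intros)
  have "continuous_on UNIV (\<lambda>A. g (diag_form lam mu (transpose V ** U ** A)))"
    by (rule continuous_on_compose2[OF cont])
       (auto simp: matrix_matrix_mult_def intro!: continuous_intros)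
  then have "(\<integral>\<omega>. g (CV U lam V mu (T \<omega>)) \<partial>P) = (\<integral>A. g (diag_form lam mu (transpose V ** U ** A)) \<partial>distr P H T)"
    unfolding CV_eq_diag_form
    by (intro integral_distr[symmetric] T X.borel_measurable_continuous)
  also have "\<dots> = (\<integral>A. g (diag_form lam mu A) \<partial>H)"
    unfolding T(2) by (rule X.integral_left_mult[OF Q cont])
  also have "\<dots> = (\<integral>A. g (diag_form (centre lam) (centre mu) A + CARD('m) * spec_moment 1 lam * spec_moment 1 mu) \<partial>H)"
    by (rule X.integral_cong_orthogonal) (simp add: diag_form_centre[of _ lam mu])
  finally show ?thesis .
qed

lemma expectation_CV: "(\<integral>\<omega>. CV U lam V mu (T \<omega>) \<partial>P) = CARD('m) * spec_moment 1 lam * spec_moment 1 mu"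
proof -
  have "(\<integral>\<omega>. CV U lam V mu (T \<omega>) \<partial>P)
      = (\<integral>A. diag_form (centre lam) (centre mu) A + CARD('m) * spec_moment 1 lam * spec_moment 1 mu \<partial>H)"
    by (rule expectation_CV_comp) (rule continuous_on_id)
  also have "\<dots> = (\<integral>A. diag_form (centre lam) (centre mu) A \<partial>H)
      + (\<integral>A. CARD('m) * spec_moment 1 lam * spec_moment 1 mu \<partial>H)"
    by (intro Bochner_Integration.integral_add X.integrable_continuous continuous_intros)
  finally show ?thesis
    by (simp add: X.integral_S[OF sum_centre] X.prob_space)
qed

lemma central_moment_CV: "central_moment P k (\<lambda>\<omega>. CV U lam V mu (T \<omega>)) = (\<integral>A. diag_form (centre lam) (centre mu) A ^ k \<partial>H)"
proof -
  have "central_moment P k (\<lambda>\<omega>. CV U lam V mu (T \<omega>)) = (\<integral>\<omega>. (CV U lam V mu (T \<omega>) - CARD('m) * spec_moment 1 lam * spec_moment 1 mu) ^ k \<partial>P)"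
    by (simp only: central_moment_def expectation_CV)
  also have "\<dots> = (\<integral>A. diag_form (centre lam) (centre mu) A ^ k \<partial>H)"
    by (subst expectation_CV_comp) (auto intro!: continuous_intros)
  finally show ?thesis .
qed

lemma central_moment_2_CV:
  assumes "2 \<le> CARD('m)"
  shows "central_moment P 2 (\<lambda>\<omega>. CV U lam V mu (T \<omega>))
    = 2 * (real CARD('m))\<^sup>2 / ((real CARD('m) - 1) * (real CARD('m) + 2)) * spec_cmoment 2 lam * spec_cmoment 2 mu"
proof -
  have "1 < real CARD('m)"
    using assms by simp
  then show ?thesis
    using mult_imp_eq_divide[OF X.integral_S2[OF sum_centre assms, of mu]]
    unfolding central_moment_CV sum_centre_power
    by (simp add: power2_eq_square mult_ac)
qed

lemma central_moment_3_CV: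
  assumes "3 \<le> CARD('m)"
  shows "central_moment P 3 (\<lambda>\<omega>. CV U lam V mu (T \<omega>))
    = 8 * (real CARD('m))^3 / ((real CARD('m) - 2) * (real CARD('m) - 1) * (real CARD('m) + 2) * (real CARD('m) + 4))
      * spec_cmoment 3 lam * spec_cmoment 3 mu"
proof -
  have "2 < real CARD('m)"
    using assms by simp
  then show ?thesis
    using mult_imp_eq_divide[OF X.integral_S3[OF sum_centre assms, of mu]]
    unfolding central_moment_CV sum_centre_power
    by (simp add: power3_eq_cube mult_ac)
qed

lemma central_moment_4_CV:
  assumes "4 \<le> CARD('m)" "N = real CARD('m) + 1"
  shows "central_moment P 4 (\<lambda>\<omega>. CV U lam V mu (T \<omega>))
    = 12 * (N - 1)^3 / ((N - 4) * (N - 3) * (N - 2) * N * (N + 1) * (N + 3) * (N + 5)) *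
              (4 * (N^2 - N + 2) * spec_cmoment 4 lam * spec_cmoment 4 mu
               + (N^4 + N^3 - 15 * N^2 - 13 * N + 98) * (spec_cmoment 2 lam)^2 * (spec_cmoment 2 mu)^2
               - 4 * (2 * N^2 - N - 7) *
                 (spec_cmoment 4 lam * (spec_cmoment 2 mu)^2
                  + (spec_cmoment 2 lam)^2 * spec_cmoment 4 mu))"
  using X.integral_S4[OF sum_centre assms, of mu]
  unfolding central_moment_CV sum_centre_power by simp

end

section \<open>From \<open>CV\<close> to the normalised coefficient \<open>RV\<close>\<close>

lemma central_moment_divide: "central_moment M k (\<lambda>\<omega>. X \<omega> / s) = central_moment M k X / s ^ k"
  by (simp add: central_moment_def power_divide flip: diff_divide_distrib)

lemma skewness_scaling:
  fixes c2 c3 s x y x3 y3 d :: real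
  assumes d: "2 < d" and s: "0 < s" and x: "0 < x" and y: "0 < y"
    and c2: "c2 = 2 * d\<^sup>2 / ((d - 1) * (d + 2)) * x * y"
    and c3: "c3 = 8 * d ^ 3 / ((d - 2) * (d - 1) * (d + 2) * (d + 4)) * x3 * y3"
  shows "c3 / s ^ 3 / (c2 / s\<^sup>2) powr (3/2)
    = sqrt (8 * (d - 1) * (d + 2)) / ((d - 2) * (d + 4)) * (x3 / x powr (3/2)) * (y3 / y powr (3/2))"
proof -
  define k where "k = 2 * d\<^sup>2 / ((d - 1) * (d + 2))"
  have k: "k > 0"
    using d by (simp add: k_def)
  have half: "z powr (3/2) = z * sqrt z" if "z > 0" for z :: real
  proof -
    have "z powr (3/2) = z powr (1 + 1/2)"
      by simp
    also have "\<dots> = z * sqrt z"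
      using that by (simp only: powr_add powr_half_sqrt) simp
    finally show ?thesis .
  qed
  have "s\<^sup>2 powr (3/2) = s ^ 3"
    using s by (simp add: half power2_eq_square power3_eq_cube real_sqrt_mult)
  then have "(c2 / s\<^sup>2) powr (3/2) = k powr (3/2) * x powr (3/2) * y powr (3/2) / s ^ 3"
    using k x y s by (simp add: c2 powr_divide powr_mult flip: k_def)
  then have 1: "c3 / s ^ 3 / (c2 / s\<^sup>2) powr (3/2) = c3 / (k powr (3/2) * x powr (3/2) * y powr (3/2))"
    using s by simp
  have "k * ((d - 1) * (d + 2)) = 2 * d\<^sup>2"
    using d by (simp add: k_def)
  \<comment> \<open>The constant 8 of the skewness makes this product a perfect square, so the root
    of \<open>k\<close> in \<open>k powr (3/2)\<close> combines with the root in the claim to the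
    rational factor \<open>4 * d\<close>.\<close>
  then have "k * (8 * (d - 1) * (d + 2)) = (4 * d)\<^sup>2"
    by algebra
  then have "sqrt k * sqrt (8 * (d - 1) * (d + 2)) = \<bar>4 * d\<bar>"
    by (simp only: real_sqrt_abs flip: real_sqrt_mult)
  then have "k powr (3/2) * sqrt (8 * (d - 1) * (d + 2)) = k * (4 * d)"
    using d by (simp only: half[OF k] mult.assoc)
  also have "\<dots> = 8 * d ^ 3 / ((d - 1) * (d + 2))"
    by (simp add: k_def power2_eq_square power3_eq_cube)
  finally have c3': "c3 = k powr (3/2) * sqrt (8 * (d - 1) * (d + 2)) / ((d - 2) * (d + 4)) * x3 * y3"
    unfolding c3 by (simp add: mult_ac)
  show ?thesis
    unfolding 1 unfolding c3' using k by (simp add: mult.assoc)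
qed

theorem corollary1:
  fixes f :: "real^'n" and KX KY :: "real^'n^'n"
    and U V :: "real^('m::{finite,linorder})^'n" and lam mu :: "real^('m::{finite,linorder})"
    and H :: "(real^('m::{finite,linorder})^('m::{finite,linorder})) measure"
    and P :: "'w measure" and T :: "'w \<Rightarrow> real^('m::{finite,linorder})^('m::{finite,linorder})"
    and n :: nat
  assumes n: "n = CARD('n)" "CARD('n) = CARD('m) + 1"
    and f: "weights f"
    and KX: "standard_kernel f KX" "KX \<noteq> 0" "spectral_decomposition f KX U lam"
    and KY: "standard_kernel f KY" "KY \<noteq> 0" "spectral_decomposition f KY V mu"
    and H: "haar_orthogonal H"
    and P: "prob_space P"
    and T: "T \<in> P \<rightarrow>\<^sub>M H" "distr P H T = H"
  shows
    "let N = real n;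
         RVT = (\<lambda>\<omega>. RV KX U lam KY V mu (T \<omega>));
         CVT = (\<lambda>\<omega>. CV U lam V mu (T \<omega>));
         m2 = 2 * (N - 1)^2 / ((N - 2) * (N + 1)) * spec_cmoment 2 lam * spec_cmoment 2 mu;
         m4 = 12 * (N - 1)^3 / ((N - 4) * (N - 3) * (N - 2) * N * (N + 1) * (N + 3) * (N + 5)) *
              (4 * (N^2 - N + 2) * spec_cmoment 4 lam * spec_cmoment 4 mu
               + (N^4 + N^3 - 15 * N^2 - 13 * N + 98) * (spec_cmoment 2 lam)^2 * (spec_cmoment 2 mu)^2
               - 4 * (2 * N^2 - N - 7) *
                 (spec_cmoment 4 lam * (spec_cmoment 2 mu)^2
                  + (spec_cmoment 2 lam)^2 * spec_cmoment 4 mu))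
     in
       (n \<ge> 2 \<longrightarrow>
          prob_space.expectation P RVT
            = 1 / (N - 1) * (trace KX * trace KY / sqrt (trace (KX ** KX) * trace (KY ** KY))) \<and>
          prob_space.expectation P RVT
            = spec_moment 1 lam * spec_moment 1 mu / sqrt (spec_moment 2 lam * spec_moment 2 mu) \<and>
          prob_space.expectation P RVT = sqrt (eff_dim lam * eff_dim mu) / (N - 1)) \<and>
       (n \<ge> 3 \<longrightarrow>
          prob_space.variance P RVT = central_moment P 2 RVT \<and>
          central_moment P 2 RVT
            = 2 * (N - 1 - eff_dim lam) * (N - 1 - eff_dim mu) / ((N - 2) * (N - 1)^2 * (N + 1))) \<and>
       (n \<ge> 4 \<and> spec_cmoment 2 lam > 0 \<and> spec_cmoment 2 mu > 0 \<longrightarrow>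
          central_moment P 3 RVT / central_moment P 2 RVT powr (3/2)
            = sqrt (8 * (N - 2) * (N + 1)) / ((N - 3) * (N + 3)) * spec_skewness lam * spec_skewness mu) \<and>
       (n \<ge> 5 \<and> spec_cmoment 2 lam > 0 \<and> spec_cmoment 2 mu > 0 \<longrightarrow>
          central_moment P 4 RVT / (central_moment P 2 RVT)^2 - 3 = m4 / m2^2 - 3 \<and>
          central_moment P 2 CVT = m2 \<and>
          central_moment P 4 CVT = m4)"
proof -
  define d where "d = real CARD('m)"
  define s where "s = sqrt (trace (KX ** KX) * trace (KY ** KY))"
  have N: "real n = d + 1"
    using n by (simp add: d_def)
  \<comment> \<open>The thresholds on \<open>n\<close> are exactly the points from which
    \<open>d - 1\<close>, \<open>d - 2\<close> and \<open>d - 3\<close> are positive.\<close>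
  have d: "1 \<le> d" "1 < d \<longleftrightarrow> 3 \<le> n" "2 < d \<longleftrightarrow> 4 \<le> n" "3 < d \<longleftrightarrow> 5 \<le> n"
    using n by (auto simp: d_def Suc_le_eq)
  note X = spectral_decomposition_traces[OF KX(3)] and Y = spectral_decomposition_traces[OF KY(3)]
  define p r where "p = (\<Sum>i\<in>UNIV. (lam $ i)\<^sup>2)" and "r = (\<Sum>i\<in>UNIV. (mu $ i)\<^sup>2)"
  have pr: "0 < p" "0 < r"
    using X(3)[OF KX(2)] Y(3)[OF KY(2)] by (simp_all add: p_def r_def)
  have s: "s = sqrt (p * r)" "0 < s" "s\<^sup>2 = p * r"
    using pr by (simp_all add: s_def X(2) Y(2) p_def r_def)
  define P1 R1 where "P1 = (\<Sum>i\<in>UNIV. lam $ i)" and "R1 = (\<Sum>i\<in>UNIV. mu $ i)"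
  \<comment> \<open>The sign matters for the third form of the mean: the root of
    \<open>P1\<^sup>2\<close> has to be \<open>P1\<close> itself.\<close>
  have PR1: "0 \<le> P1" "0 \<le> R1"
    using KX(3) KY(3) by (auto simp: P1_def R1_def spectral_decomposition_def intro!: sum_nonneg)
  have m1: "spec_moment 1 lam = P1 / d" "spec_moment 1 mu = R1 / d"
    and m2: "spec_moment 2 lam = p / d" "spec_moment 2 mu = r / d"
    by (simp_all add: spec_moment_def P1_def R1_def p_def r_def d_def)
  have nu: "eff_dim lam = P1\<^sup>2 / p" "eff_dim mu = R1\<^sup>2 / r"
    by (simp_all add: eff_dim_def P1_def R1_def p_def r_def)
  note CV = H T orthogonal_matrix_spectral_bases[OF KX(3) KY(3)]
  let ?CV = "\<lambda>\<omega>. CV U lam V mu (T \<omega>)"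
  let ?RV = "\<lambda>\<omega>. RV KX U lam KY V mu (T \<omega>)"
  have RV: "?RV = (\<lambda>\<omega>. ?CV \<omega> / s)"
    by (simp add: RV_def s_def)
  have RV_moment: "central_moment P k ?RV = central_moment P k ?CV / s ^ k" for k
    unfolding RV by (rule central_moment_divide)
  have E: "prob_space.expectation P ?RV = P1 * R1 / (d * s)"
    using expectation_CV[OF CV] d(1) by (simp add: RV m1 del: One_nat_def flip: d_def)
  have E1: "prob_space.expectation P ?RV = 1 / (real n - 1) * (trace KX * trace KY / s)"
    by (simp add: E N X(1) Y(1) P1_def R1_def)
  have E2: "prob_space.expectation P ?RV
      = spec_moment 1 lam * spec_moment 1 mu / sqrt (spec_moment 2 lam * spec_moment 2 mu)"
    using d(1) by (simp add: E m1 m2 s(1) real_sqrt_mult real_sqrt_divide del: One_nat_def)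
  have E3: "prob_space.expectation P ?RV = sqrt (eff_dim lam * eff_dim mu) / (real n - 1)"
    using PR1 by (simp add: E nu N s(1) real_sqrt_mult real_sqrt_divide)
  have c2: "central_moment P 2 ?CV = 2 * d\<^sup>2 / ((d - 1) * (d + 2)) * spec_cmoment 2 lam * spec_cmoment 2 mu"
    if "1 < d"
    using central_moment_2_CV[OF CV] that by (simp add: d_def)
  have V: "central_moment P 2 ?RV
      = 2 * (real n - 1 - eff_dim lam) * (real n - 1 - eff_dim mu) / ((real n - 2) * (real n - 1)\<^sup>2 * (real n + 1))"
    if "1 < d"
  proof -
    \<comment> \<open>The second central moment is \<open>p / d - (P1 / d)\<^sup>2\<close>, and
      \<open>P1\<^sup>2\<close> is \<open>p * eff_dim lam\<close>. The factors \<open>p\<close> and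
      \<open>r\<close> then cancel against \<open>s\<^sup>2\<close>.\<close>
    have x: "spec_cmoment 2 lam = p * (d - eff_dim lam) / d\<^sup>2" "spec_cmoment 2 mu = r * (d - eff_dim mu) / d\<^sup>2"
      using that pr unfolding spec_cmoment_2 m1 m2 nu by (simp_all add: field_simps power2_eq_square)
    have "central_moment P 2 ?RV = (2 * d\<^sup>2 / ((d - 1) * (d + 2)) * (p * (d - eff_dim lam) / d\<^sup>2)
        * (r * (d - eff_dim mu) / d\<^sup>2)) / (p * r)"
      unfolding RV_moment c2[OF that] x s(3) ..
    also have "\<dots> = 2 * (d - eff_dim lam) * (d - eff_dim mu) / ((d - 1) * d\<^sup>2 * (d + 2))"
      using that pr by (simp add: mult_ac)
    finally show ?thesis
      by (simp add: N algebra_simps)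
  qed
  have S: "central_moment P 3 ?RV / central_moment P 2 ?RV powr (3/2)
      = sqrt (8 * (real n - 2) * (real n + 1)) / ((real n - 3) * (real n + 3)) * spec_skewness lam * spec_skewness mu"
    if "2 < d" "0 < spec_cmoment 2 lam" "0 < spec_cmoment 2 mu"
  proof -
    have "1 < d" "3 \<le> CARD('m)"
      using that(1) by (simp_all add: d_def)
    from central_moment_3_CV[OF CV this(2)]
    have "central_moment P 3 ?CV = 8 * d ^ 3 / ((d - 2) * (d - 1) * (d + 2) * (d + 4)) * spec_cmoment 3 lam * spec_cmoment 3 mu"
      by (simp only: d_def)
    from skewness_scaling[OF that(1) s(2) that(2,3) c2[OF \<open>1 < d\<close>] this]
    show ?thesis
      unfolding RV_moment spec_skewness_def N by (simp add: add.commute)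
  qed
  have c4: "central_moment P 4 ?CV = 12 * (real n - 1)^3 / ((real n - 4) * (real n - 3) * (real n - 2) * real n * (real n + 1) * (real n + 3) * (real n + 5)) *
              (4 * ((real n)^2 - real n + 2) * spec_cmoment 4 lam * spec_cmoment 4 mu
               + ((real n)^4 + (real n)^3 - 15 * (real n)^2 - 13 * real n + 98) * (spec_cmoment 2 lam)^2 * (spec_cmoment 2 mu)^2
               - 4 * (2 * (real n)^2 - real n - 7) *
                 (spec_cmoment 4 lam * (spec_cmoment 2 mu)^2
                  + (spec_cmoment 2 lam)^2 * spec_cmoment 4 mu))" if "3 < d"
    using central_moment_4_CV[OF CV, of "real n"] that N by (simp add: d_def)
  have K: "central_moment P 4 ?RV / (central_moment P 2 ?RV)\<^sup>2 = central_moment P 4 ?CV / (central_moment P 2 ?CV)\<^sup>2"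
    using s(2) by (simp add: RV_moment power_divide flip: power_mult)
  have c2': "central_moment P 2 ?CV = 2 * (real n - 1)\<^sup>2 / ((real n - 2) * (real n + 1)) * spec_cmoment 2 lam * spec_cmoment 2 mu"
    if "1 < d"
    unfolding c2[OF that] N by (simp add: add.commute)
  show ?thesis
    unfolding Let_def
  proof (intro conjI impI)
    show "prob_space.variance P ?RV = central_moment P 2 ?RV"
      by (simp add: central_moment_def)
  qed (use E1 E2 E3 V S K c2' c4 d in \<open>auto simp: s_def\<close>)
qed

end
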